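(* Fix a field and a degree $d\ge0$. Let $(\alpha,T)\colon(\Phi,M)\to(\Psi,N)$ be a geometric SEO between incarnations of data sets $\Phi$ and $\Psi$ with domains $X$ and $Y$. Then the morphisms $PH_d^\alpha(\phi)\colon PH_d^\Psi(\alpha(\phi))\to PH_d^\Phi(\phi)$, for $\phi\in\Phi$, form a natural transformation, between functors indexed by the Grothendieck graph of $(\Phi,M)$, from the composition of $(\alpha,T)$ with the persistent homology functor of $(\Psi,N)$ to the persistent homology functor of $(\Phi,M)$. That is, for every $\phi\in\Phi$ and $g\in M$, $$PH_d^{-g}(\phi)\,PH_d^{\alpha}(\phi g)=PH_d^{\alpha}(\phi)\,PH_d^{-T(g)}(\alpha(\phi))$$ as morphisms $PH_d^\Psi(\alpha(\phi g))=PH_d^\Psi(\alpha(\phi)T(g))\to PH_d^\Phi(\phi)$.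
   Context: A data set is a finite set $\Phi=\{\phi_i\colon X\to\mathbf{R}\mid i=1,\dots,m\}$ of real-valued functions (measurements) on a finite set $X$, called its domain. It induces the pseudometric $d_\Phi(x,y)=\max_{i}|\phi_i(x)-\phi_i(y)|$ on $X$. Let $\mathrm{End}_\Phi(X)$ be the monoid of functions $g\colon X\to X$ such that $\phi g\in\Phi$ for all $\phi\in\Phi$, where $\phi g=\phi\circ g$. An incarnation of $\Phi$ is a pair $(\Phi,M)$ with $M\subset\mathrm{End}_\Phi(X)$ a subset. A SEO (set equivariant operator) $(\alpha,T)\colon(\Phi,M)\to(\Psi,N)$ is a pair of functions $\alpha\colon\Phi\to\Psi$, $T\colon M\to N$ with $\alpha(\phi g)=\alpha(\phi)T(g)$ for all $\phi\in\Phi$, $g\in M$. It is geometric if there is a function $f\colon Y\to X$ (a realization) such that $\alpha(\phi)=\phi f$ for all $\phi\in\Phi$ and $f\,T(g)=g f$ for all $g\in M$. For $\phi\in\Phi$, $s\in\mathbf{R}$, $r\ge0$, write $(\phi\le s):=\phi^{-1}((-\infty,s])$, and let $\mathrm{VR}_r(\phi\le s,d_\Phi)$ be the Vietoris-Rips complex whose simplices are the (nonempty) subsets of $(\phi\le s)$ of $d_\Phi$-diameter at most $r$. Set $PH_d^\Phi(\phi)_{r,s}:=H_d(\mathrm{VR}_r(\phi\le s,d_\Phi))$ (homology with coefficients in the fixed field); with maps induced by inclusions this is a functor $PH_d^\Phi(\phi)$ from the poset $[0,\infty)\times\mathbf{R}$ to vector spaces. If $\gamma\colon\Phi\to\Psi$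 is a function between data sets with domains $X$, $Y$ such that $\gamma(\phi)=\phi f$ for all $\phi\in\Phi$ for some $f\colon Y\to X$, then $f$ is non-expansive from $d_\Psi$ to $d_\Phi$ and maps $(\gamma(\phi)\le s)$ into $(\phi\le s)$, so it induces simplicial maps of Vietoris-Rips complexes and, on $H_d$, a morphism $PH_d^\gamma(\phi)\colon PH_d^\Psi(\gamma(\phi))\to PH_d^\Phi(\phi)$, which does not depend on the choice of such $f$. For $g\in M$, $-g\colon\Phi\to\Phi$ denotes $\phi\mapsto\phi g$, realized by $g\colon X\to X$, giving $PH_d^{-g}(\phi)\colon PH_d^\Phi(\phi g)\to PH_d^\Phi(\phi)$. The Grothendieck graph of $(\Phi,M)$ has vertex set $\Phi$ and edges $(\phi,g,\phi g)$ for $\phi\in\Phi$, $g\in M$. The persistent homology functor of $(\Phi,M)$ assigns $PH_d^\Phi(\phi)$ to $\phi$ and $PH_d^{-g}(\phi)$ to the edge $(\phi,g,\phi g)$. The composition of $(\alpha,T)$ with the persistent homology functor of $(\Psi,N)$ assigns $PH_d^\Psi(\alpha(\phi))$ to $\phi$ and $PH_d^{-T(g)}(\alpha(\phi))$ to the edge $(\phi,g,\phi g)$. *)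

theory Defs
  imports
    "HOL-Library.FuncSet"
    "HOL-Algebra.AbelCoset"
    "Jordan_Normal_Form.VS_Connect"
    "Graph_Theory.Digraph"
begin

section \<open>Simplicial homology with coefficients in a field\<close>

text \<open>
  A simplicial complex is given by its set of simplices, a set of finite nonempty sets of vertices.
  Following the classical definition of oriented chains, a \<open>p\<close>-chain is a finitely supported
  function \<open>c\<close> on the tuples that enumerate a \<open>p\<close>-simplex without repetition such that \<open>c\<close>
  changes sign when two vertices are exchanged (adjacent transpositions suffice). Hence
  \<open>c = (\<Sum>\<sigma>. c \<sigma> \<cdot> [\<sigma>])\<close>, where \<open>\<sigma>\<close> runs over one chosen enumeration of every simplex and \<open>[\<sigma>]\<close>
  takes the value \<open>1\<close> on the even and \<open>-1\<close> on the odd rearrangements of \<open>\<sigma>\<close>.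
\<close>

definition oriented_chains :: "'a set set \<Rightarrow> nat \<Rightarrow> ('a list \<Rightarrow> 'k::field) set" where
  "oriented_chains K p = {c. finite {vs. c vs \<noteq> 0} \<and>
     (\<forall>vs. c vs \<noteq> 0 \<longrightarrow> distinct vs \<and> length vs = Suc p \<and> set vs \<in> K) \<and>
     (\<forall>xs x y ys. c (xs @ y # x # ys) = - c (xs @ x # y # ys))}"

definition chain_space :: "'a set set \<Rightarrow> nat \<Rightarrow> ('k::field, 'a list \<Rightarrow> 'k) module" where
  "chain_space K p = \<lparr>carrier = oriented_chains K p, mult = undefined, one = undefined,
     zero = (\<lambda>_. 0), add = (\<lambda>c c' vs. c vs + c' vs), smult = (\<lambda>a c vs. a * c vs)\<rparr>"

text \<open>
  The linear map with \<open>[v\<^sub>0,\<dots>,v\<^sub>p] \<mapsto> (\<Sum>i. (-1)^i \<cdot> [v\<^sub>0,\<dots>,v\<^sub>i\<^sub>-\<^sub>1,v\<^sub>i\<^sub>+\<^sub>1,\<dots>,v\<^sub>p])\<close>: in \<open>\<partial>c\<close>, the coefficient of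
  \<open>[ws]\<close> receives a contribution from each simplex \<open>{v} \<union> set ws\<close>, and in its enumeration
  \<open>v # ws\<close> the face \<open>ws\<close> is obtained by omitting the vertex at position \<open>0\<close>. The case of the
  empty tuple makes \<open>\<partial>\<close> zero on \<open>0\<close>-chains (no augmentation).
\<close>

definition boundary_map :: "('a list \<Rightarrow> 'k::field) \<Rightarrow> 'a list \<Rightarrow> 'k" where
  "boundary_map c ws = (if ws = [] then 0 else \<Sum>v | c (v # ws) \<noteq> 0. c (v # ws))"

definition cycles :: "'a set set \<Rightarrow> nat \<Rightarrow> ('a list \<Rightarrow> 'k::field) set" where
  "cycles K p = {c \<in> oriented_chains K p. boundary_map c = (\<lambda>_. 0)}"

definition boundaries :: "'a set set \<Rightarrow> nat \<Rightarrow> ('a list \<Rightarrow> 'k::field) set" where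
  "boundaries K p = boundary_map ` oriented_chains K (Suc p)"

definition quotient_space :: "('k, 'v) module \<Rightarrow> 'v set \<Rightarrow> ('k, 'v set) module" where
  "quotient_space V B = \<lparr>carrier = A_RCOSETS V B, mult = undefined, one = undefined,
     zero = B, add = set_add V, smult = (\<lambda>a C. \<Union>c\<in>C. a_r_coset V B (a \<odot>\<^bsub>V\<^esub> c))\<rparr>"

definition homology :: "nat \<Rightarrow> 'a set set \<Rightarrow> ('k::field, ('a list \<Rightarrow> 'k) set) module" where
  "homology p K = quotient_space ((chain_space K p)\<lparr>carrier := cycles K p\<rparr>) (boundaries K p)"

text \<open>
  The linear map with \<open>[v\<^sub>0,\<dots>,v\<^sub>p] \<mapsto> [f v\<^sub>0,\<dots>,f v\<^sub>p]\<close>, and \<open>[v\<^sub>0,\<dots>,v\<^sub>p] \<mapsto> 0\<close> if two of the vertices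
  \<open>f v\<^sub>i\<close> coincide: for an alternating \<open>c\<close> and a tuple \<open>ws\<close> with a repetition, the summands
  cancel in pairs.
\<close>

definition chain_map :: "('a \<Rightarrow> 'b) \<Rightarrow> ('a list \<Rightarrow> 'k::field) \<Rightarrow> 'b list \<Rightarrow> 'k" where
  "chain_map f c ws = (\<Sum>vs | c vs \<noteq> 0 \<and> map f vs = ws. c vs)"

definition homology_map ::
  "nat \<Rightarrow> 'a set set \<Rightarrow> 'b set set \<Rightarrow> ('a \<Rightarrow> 'b) \<Rightarrow> ('a list \<Rightarrow> 'k::field) set \<Rightarrow> ('b list \<Rightarrow> 'k) set" where
  "homology_map p K L f = (\<lambda>C \<in> carrier (homology p K).
     \<Union>c\<in>C. a_r_coset (chain_space L p) (boundaries L p) (chain_map f c))"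


section \<open>Persistence modules over the poset of pairs (r, s) with nonnegative r\<close>

definition grid :: "(real \<times> real) set" where
  "grid = {0..} \<times> UNIV"

definition grid_le :: "real \<times> real \<Rightarrow> real \<times> real \<Rightarrow> bool" where
  "grid_le p q \<longleftrightarrow> fst p \<le> fst q \<and> snd p \<le> snd q"

text \<open>Morphisms of vector spaces are extensional, so that equal morphisms are equal functions.\<close>

definition vect_hom :: "('k::field, 'v) module \<Rightarrow> ('k, 'w) module \<Rightarrow> ('v \<Rightarrow> 'w) set" where
  "vect_hom V W = {h \<in> extensional (carrier V). linear_map class_ring V W h}"

record ('k, 'v) pers =
  space :: "real \<times> real \<Rightarrow> ('k, 'v) module"
  transition :: "real \<times> real \<Rightarrow> real \<times> real \<Rightarrow> 'v \<Rightarrow> 'v"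

definition persistence_module :: "('k::field, 'v) pers \<Rightarrow> bool" where
  "persistence_module F \<longleftrightarrow>
     (\<forall>p\<in>grid. vectorspace class_ring (space F p)) \<and>
     (\<forall>p\<in>grid. \<forall>q\<in>grid. grid_le p q \<longrightarrow> transition F p q \<in> vect_hom (space F p) (space F q)) \<and>
     (\<forall>p\<in>grid. transition F p p = (\<lambda>x \<in> carrier (space F p). x)) \<and>
     (\<forall>p\<in>grid. \<forall>q\<in>grid. \<forall>r\<in>grid. grid_le p q \<longrightarrow> grid_le q r \<longrightarrow>
        transition F p r = compose (carrier (space F p)) (transition F q r) (transition F p q))"

definition pers_hom ::
  "('k::field, 'v) pers \<Rightarrow> ('k, 'w) pers \<Rightarrow> (real \<times> real \<Rightarrow> 'v \<Rightarrow> 'w) set" where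
  "pers_hom F G = {h \<in> extensional grid.
     (\<forall>p\<in>grid. h p \<in> vect_hom (space F p) (space G p)) \<and>
     (\<forall>p\<in>grid. \<forall>q\<in>grid. grid_le p q \<longrightarrow>
        compose (carrier (space F p)) (h q) (transition F p q) =
        compose (carrier (space F p)) (transition G p q) (h p))}"

text \<open>The composite \<open>k h\<close> of \<open>h\<close>, a morphism with source \<open>F\<close>, and \<open>k\<close>.\<close>

definition pers_comp ::
  "('k, 'u) pers \<Rightarrow> (real \<times> real \<Rightarrow> 'v \<Rightarrow> 'w) \<Rightarrow> (real \<times> real \<Rightarrow> 'u \<Rightarrow> 'v) \<Rightarrow>
   real \<times> real \<Rightarrow> 'u \<Rightarrow> 'w" where
  "pers_comp F k h = (\<lambda>p \<in> grid. compose (carrier (space F p)) (k p) (h p))"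


section \<open>Functors indexed by a graph, with values in persistence modules\<close>

record ('v, 'e, 'k, 'w) graph_functor =
  obj :: "'v \<Rightarrow> ('k, 'w) pers"
  arr :: "'e \<Rightarrow> real \<times> real \<Rightarrow> 'w \<Rightarrow> 'w"

text \<open>Functors are contravariant: the edge \<open>(\<phi>, g, \<phi>g)\<close> is sent to a morphism from the object at
  \<open>\<phi>g\<close> to the object at \<open>\<phi>\<close>.\<close>

definition is_graph_functor ::
  "('v, 'e) pre_digraph \<Rightarrow> ('v, 'e, 'k::field, 'w) graph_functor \<Rightarrow> bool" where
  "is_graph_functor G D \<longleftrightarrow>
     (\<forall>v \<in> verts G. persistence_module (obj D v)) \<and>
     (\<forall>e \<in> arcs G. arr D e \<in> pers_hom (obj D (head G e)) (obj D (tail G e)))"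

definition natural_transformation ::
  "('v, 'e) pre_digraph \<Rightarrow> ('v, 'e, 'k::field, 'u) graph_functor \<Rightarrow>
   ('v, 'e, 'k, 'w) graph_functor \<Rightarrow> ('v \<Rightarrow> real \<times> real \<Rightarrow> 'u \<Rightarrow> 'w) \<Rightarrow> bool" where
  "natural_transformation G D E \<eta> \<longleftrightarrow>
     is_graph_functor G D \<and> is_graph_functor G E \<and>
     (\<forall>v \<in> verts G. \<eta> v \<in> pers_hom (obj D v) (obj E v)) \<and>
     (\<forall>e \<in> arcs G. pers_comp (obj D (head G e)) (arr E e) (\<eta> (head G e)) =
                   pers_comp (obj D (head G e)) (\<eta> (tail G e)) (arr D e))"


section \<open>Data sets, incarnations and set equivariant operators\<close>

text \<open>
  Domains are finite, possibly empty, sets \<open>X\<close> rather than types. Functions on \<open>X\<close> are extensional,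
  so that equality of measurements is equality of functions on \<open>X\<close>, and \<open>\<phi>g\<close> is
  \<open>compose X \<phi> g\<close>.
\<close>

definition data_set :: "'a set \<Rightarrow> ('a \<Rightarrow> real) set \<Rightarrow> bool" where
  "data_set X \<Phi> \<longleftrightarrow> finite X \<and> finite \<Phi> \<and> \<Phi> \<subseteq> extensional X"

text \<open>The maximum is unspecified for empty \<open>\<Phi>\<close>, where no persistent homology is ever taken.\<close>

definition data_dist :: "('a \<Rightarrow> real) set \<Rightarrow> 'a \<Rightarrow> 'a \<Rightarrow> real" where
  "data_dist \<Phi> x y = Max ((\<lambda>\<phi>. \<bar>\<phi> x - \<phi> y\<bar>) ` \<Phi>)"

definition data_End :: "'a set \<Rightarrow> ('a \<Rightarrow> real) set \<Rightarrow> ('a \<Rightarrow> 'a) set" where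
  "data_End X \<Phi> = {g \<in> X \<rightarrow>\<^sub>E X. \<forall>\<phi>\<in>\<Phi>. compose X \<phi> g \<in> \<Phi>}"

definition incarnation :: "'a set \<Rightarrow> ('a \<Rightarrow> real) set \<Rightarrow> ('a \<Rightarrow> 'a) set \<Rightarrow> bool" where
  "incarnation X \<Phi> M \<longleftrightarrow> data_set X \<Phi> \<and> M \<subseteq> data_End X \<Phi>"

definition is_SEO ::
  "'a set \<Rightarrow> ('a \<Rightarrow> real) set \<Rightarrow> ('a \<Rightarrow> 'a) set \<Rightarrow> 'b set \<Rightarrow> ('b \<Rightarrow> real) set \<Rightarrow> ('b \<Rightarrow> 'b) set \<Rightarrow>
   (('a \<Rightarrow> real) \<Rightarrow> 'b \<Rightarrow> real) \<Rightarrow> (('a \<Rightarrow> 'a) \<Rightarrow> 'b \<Rightarrow> 'b) \<Rightarrow> bool" where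
  "is_SEO X \<Phi> M Y \<Psi> N \<alpha> T \<longleftrightarrow> \<alpha> \<in> \<Phi> \<rightarrow> \<Psi> \<and> T \<in> M \<rightarrow> N \<and>
     (\<forall>\<phi>\<in>\<Phi>. \<forall>g\<in>M. \<alpha> (compose X \<phi> g) = compose Y (\<alpha> \<phi>) (T g))"

text \<open>\<open>f : Y \<rightarrow> X\<close> satisfies \<open>\<gamma>(\<phi>) = \<phi>f\<close> for all \<open>\<phi> \<in> \<Phi>\<close>.\<close>

definition realizes ::
  "'a set \<Rightarrow> ('a \<Rightarrow> real) set \<Rightarrow> 'b set \<Rightarrow> (('a \<Rightarrow> real) \<Rightarrow> 'b \<Rightarrow> real) \<Rightarrow> ('b \<Rightarrow> 'a) \<Rightarrow> bool" where
  "realizes X \<Phi> Y \<gamma> f \<longleftrightarrow> f \<in> Y \<rightarrow>\<^sub>E X \<and> (\<forall>\<phi>\<in>\<Phi>. \<gamma> \<phi> = compose Y \<phi> f)"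

definition geometric_SEO ::
  "'a set \<Rightarrow> ('a \<Rightarrow> real) set \<Rightarrow> ('a \<Rightarrow> 'a) set \<Rightarrow> 'b set \<Rightarrow> ('b \<Rightarrow> real) set \<Rightarrow> ('b \<Rightarrow> 'b) set \<Rightarrow>
   (('a \<Rightarrow> real) \<Rightarrow> 'b \<Rightarrow> real) \<Rightarrow> (('a \<Rightarrow> 'a) \<Rightarrow> 'b \<Rightarrow> 'b) \<Rightarrow> bool" where
  "geometric_SEO X \<Phi> M Y \<Psi> N \<alpha> T \<longleftrightarrow> is_SEO X \<Phi> M Y \<Psi> N \<alpha> T \<and>
     (\<exists>f. realizes X \<Phi> Y \<alpha> f \<and> (\<forall>g\<in>M. compose Y f (T g) = compose Y g f))"

definition grothendieck_graph ::
  "'a set \<Rightarrow> ('a \<Rightarrow> real) set \<Rightarrow> ('a \<Rightarrow> 'a) set \<Rightarrow>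
   ('a \<Rightarrow> real, ('a \<Rightarrow> real) \<times> ('a \<Rightarrow> 'a) \<times> ('a \<Rightarrow> real)) pre_digraph" where
  "grothendieck_graph X \<Phi> M = \<lparr>verts = \<Phi>,
     arcs = {(\<phi>, g, compose X \<phi> g) | \<phi> g. \<phi> \<in> \<Phi> \<and> g \<in> M},
     tail = (\<lambda>(\<phi>, g, \<psi>). \<phi>), head = (\<lambda>(\<phi>, g, \<psi>). \<psi>)\<rparr>"


section \<open>Persistent homology of data sets\<close>

definition vietoris_rips :: "real \<Rightarrow> 'a set \<Rightarrow> ('a \<Rightarrow> 'a \<Rightarrow> real) \<Rightarrow> 'a set set" where
  "vietoris_rips r A \<delta> = {\<sigma>. \<sigma> \<noteq> {} \<and> finite \<sigma> \<and> \<sigma> \<subseteq> A \<and> (\<forall>x\<in>\<sigma>. \<forall>y\<in>\<sigma>. \<delta> x y \<le> r)}"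

definition sublevel_VR ::
  "'a set \<Rightarrow> ('a \<Rightarrow> real) set \<Rightarrow> ('a \<Rightarrow> real) \<Rightarrow> real \<times> real \<Rightarrow> 'a set set" where
  "sublevel_VR X \<Phi> \<phi> p = vietoris_rips (fst p) {x \<in> X. \<phi> x \<le> snd p} (data_dist \<Phi>)"

definition PH ::
  "nat \<Rightarrow> 'a set \<Rightarrow> ('a \<Rightarrow> real) set \<Rightarrow> ('a \<Rightarrow> real) \<Rightarrow> ('k::field, ('a list \<Rightarrow> 'k) set) pers" where
  "PH d X \<Phi> \<phi> = \<lparr>space = (\<lambda>p. homology d (sublevel_VR X \<Phi> \<phi> p)),
     transition = (\<lambda>p q. homology_map d (sublevel_VR X \<Phi> \<phi> p) (sublevel_VR X \<Phi> \<phi> q) (\<lambda>x. x))\<rparr>"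

text \<open>The morphism from \<open>PH d Y \<Psi> (\<gamma> \<phi>)\<close> to \<open>PH d X \<Phi> \<phi>\<close> induced by a function \<open>\<gamma> : \<Phi> \<rightarrow> \<Psi>\<close>
  that has a realization; it does not depend on which one is chosen.\<close>

definition PH_map ::
  "nat \<Rightarrow> 'a set \<Rightarrow> ('a \<Rightarrow> real) set \<Rightarrow> 'b set \<Rightarrow> ('b \<Rightarrow> real) set \<Rightarrow>
   (('a \<Rightarrow> real) \<Rightarrow> 'b \<Rightarrow> real) \<Rightarrow> ('a \<Rightarrow> real) \<Rightarrow>
   real \<times> real \<Rightarrow> ('b list \<Rightarrow> 'k::field) set \<Rightarrow> ('a list \<Rightarrow> 'k) set" where
  "PH_map d X \<Phi> Y \<Psi> \<gamma> \<phi> = (\<lambda>p \<in> grid.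
     homology_map d (sublevel_VR Y \<Psi> (\<gamma> \<phi>) p) (sublevel_VR X \<Phi> \<phi> p) (SOME f. realizes X \<Phi> Y \<gamma> f))"

text \<open>The value \<open>PH_d^{-g}(\<phi>)\<close> on the edge \<open>(\<phi>, g, \<phi>g)\<close>.\<close>

definition PH_functor ::
  "nat \<Rightarrow> 'a set \<Rightarrow> ('a \<Rightarrow> real) set \<Rightarrow>
   ('a \<Rightarrow> real, ('a \<Rightarrow> real) \<times> ('a \<Rightarrow> 'a) \<times> ('a \<Rightarrow> real), 'k::field, ('a list \<Rightarrow> 'k) set) graph_functor" where
  "PH_functor d X \<Phi> = \<lparr>obj = PH d X \<Phi>,
     arr = (\<lambda>(\<phi>, g, \<psi>). PH_map d X \<Phi> X \<Phi> (\<lambda>\<chi>. compose X \<chi> g) \<phi>)\<rparr>"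

definition SEO_composite ::
  "(('a \<Rightarrow> real) \<Rightarrow> 'b \<Rightarrow> real) \<Rightarrow> (('a \<Rightarrow> 'a) \<Rightarrow> 'b \<Rightarrow> 'b) \<Rightarrow>
   ('b \<Rightarrow> real, ('b \<Rightarrow> real) \<times> ('b \<Rightarrow> 'b) \<times> ('b \<Rightarrow> real), 'k, 'w) graph_functor \<Rightarrow>
   ('a \<Rightarrow> real, ('a \<Rightarrow> real) \<times> ('a \<Rightarrow> 'a) \<times> ('a \<Rightarrow> real), 'k, 'w) graph_functor" where
  "SEO_composite \<alpha> T D = \<lparr>obj = (\<lambda>\<phi>. obj D (\<alpha> \<phi>)),
     arr = (\<lambda>(\<phi>, g, \<psi>). arr D (\<alpha> \<phi>, T g, \<alpha> \<psi>))\<rparr>"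

end

theory Submission
  imports Defs
begin

text \<open>
  If \<open>f\<close> realizes \<open>\<alpha>\<close>, both sides of the naturality square are induced by realizations of the same
  function \<open>\<phi> \<mapsto> \<alpha>(\<phi>g)\<close>. Two realizations \<open>h, h'\<close> of one function have \<open>\<phi>h = \<phi>h'\<close> for all \<open>\<phi>\<close>, so they are
  at distance \<open>0\<close> from each other and hence contiguous between the Vietoris-Rips complexes. Contiguous
  maps induce the same map on homology: \<open>h\<close> can be changed into \<open>h'\<close> one vertex \<open>v\<close> at a time. If the
  maps differ only at \<open>v\<close>, write a cycle as \<open>v * a + b\<close> with \<open>v\<close> in neither \<open>a\<close> nor \<open>b\<close>. Then \<open>\<partial>a = 0\<close>, and
  the images of the cycle differ by the boundary of \<open>h'v * hv * h a\<close>, where \<open>*\<close> is the join. This avoids the prism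
  operator, which does not respect the alternation of chains.
\<close>

section \<open>Alternating functions on tuples\<close>

text \<open>Degree, support and complex are left out, unlike in \<open>oriented_chains\<close>, so
  that the property passes to the slices \<open>\<lambda>us. c (u # us)\<close> and induction on
  tuples is possible.\<close>

definition alternating :: "('a list \<Rightarrow> 'k::field) \<Rightarrow> bool" where
  "alternating c \<longleftrightarrow> (\<forall>xs x y ys. c (xs @ y # x # ys) = - c (xs @ x # y # ys)) \<and>
     (\<forall>vs. \<not> distinct vs \<longrightarrow> c vs = 0)"

lemma alternating_swap:
  assumes "alternating c"
  shows "c (xs @ y # x # ys) = - c (xs @ x # y # ys)"
proof -
  have "\<forall>xs x y ys. c (xs @ y # x # ys) = - c (xs @ x # y # ys)"
    using assms unfolding alternating_def by (rule conjunct1)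
  then show ?thesis by (elim allE)
qed

lemma alternating_swap_hd: "alternating c \<Longrightarrow> c (y # x # ys) = - c (x # y # ys)"
  using alternating_swap[of c "[]" y x ys] by simp

lemma alternating_not_distinct: "alternating c \<Longrightarrow> \<not> distinct vs \<Longrightarrow> c vs = 0"
  unfolding alternating_def by blast

text \<open>In characteristic 2 the sign rule does not force the value 0 on tuples with a repetition.\<close>

lemma alternatingI:
  assumes swap: "\<And>xs x y ys. c (xs @ y # x # ys) = - c (xs @ x # y # ys)"
    and rep: "\<And>xs x ys. c (xs @ x # x # ys) = 0"
  shows "alternating c"
proof -
  have far: "c (xs @ x # ys @ x # zs) = 0" for xs x ys zs
  proof (induction ys arbitrary: xs)
    case Nil
    then show ?case using rep by simp
  next
    case (Cons y ys)
    have "c (xs @ x # y # ys @ x # zs) = - c ((xs @ [y]) @ x # ys @ x # zs)"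
      using swap[of xs x y "ys @ x # zs"] by simp
    then show ?case using Cons.IH[of "xs @ [y]"] by simp
  qed
  have "c vs = 0" if "\<not> distinct vs" for vs
  proof -
    obtain xs ys zs y where "vs = xs @ [y] @ ys @ [y] @ zs"
      using not_distinct_decomp[OF \<open>\<not> distinct vs\<close>] by blast
    then show ?thesis using far[of xs y ys zs] by simp
  qed
  then show ?thesis unfolding alternating_def by (intro conjI allI impI swap)
qed

lemma alternating_Cons:
  assumes "alternating c"
  shows "alternating (\<lambda>us. c (u # us))"
proof (rule alternatingI)
  show "c (u # xs @ y # x # ys) = - c (u # xs @ x # y # ys)" for xs x y ys
    using alternating_swap[OF assms, of "u # xs" y x ys] by simp
  show "c (u # xs @ x # x # ys) = 0" for xs x ys
    using alternating_not_distinct[OF assms] by simp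
qed

text \<open>The terms at \<open>(x, y)\<close> and \<open>(y, x)\<close> cancel. The diagonal is a
  separate hypothesis because antisymmetry does not make it 0 in characteristic 2.\<close>

lemma sum_antisymmetric_eq_0:
  fixes h :: "'a \<Rightarrow> 'a \<Rightarrow> 'k::ab_group_add"
  assumes "finite A" "\<And>x y. h x y = - h y x" "\<And>x. h x x = 0"
  shows "(\<Sum>x\<in>A. \<Sum>y\<in>A. h x y) = 0"
  using assms(1)
proof (induction A)
  case (insert a A)
  have "(\<Sum>x\<in>A. h x a) = - (\<Sum>x\<in>A. h a x)"
    unfolding sum_negf[symmetric] by (intro sum.cong refl assms(2))
  then show ?case using insert assms(3) by (simp add: sum.distrib)
qed simp

subsection \<open>Boundary, push-forward and join with a vertex\<close>

text \<open>Summing over a fixed set \<open>V\<close> instead of the support makes this linear in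
  \<open>c\<close> without side conditions. At \<open>[]\<close> it is the augmentation, which
  \<open>boundary_map\<close> omits but \<open>bd_join\<close> relies on when \<open>a\<close> is a
  0-chain.\<close>

definition bd :: "'a set \<Rightarrow> ('a list \<Rightarrow> 'k::field) \<Rightarrow> 'a list \<Rightarrow> 'k" where
  "bd V c ws = (\<Sum>v\<in>V. c (v # ws))"

text \<open>A form of \<open>chain_map\<close> with one sum per entry: it allows induction on the
  target tuple and needs no support condition on \<open>c\<close>.\<close>

fun push :: "'a set \<Rightarrow> ('a \<Rightarrow> 'b) \<Rightarrow> ('a list \<Rightarrow> 'k::field) \<Rightarrow> 'b list \<Rightarrow> 'k" where
  "push V f c [] = c []"
| "push V f c (w # ws) = (\<Sum>u | u \<in> V \<and> f u = w. push V f (\<lambda>us. c (u # us)) ws)"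

text \<open>The linear map with \<open>[v\<^sub>0,\<dots>,v\<^sub>p] \<mapsto> [x,v\<^sub>0,\<dots>,v\<^sub>p]\<close>: the value at \<open>ws\<close> is the alternating sum
  over the positions of \<open>x\<close> in \<open>ws\<close> of the values of \<open>a\<close> at \<open>ws\<close> with that position omitted.\<close>

fun join :: "'a \<Rightarrow> ('a list \<Rightarrow> 'k::field) \<Rightarrow> 'a list \<Rightarrow> 'k" where
  "join x a [] = 0"
| "join x a (y # ys) = (if y = x then a ys else 0) - join x (\<lambda>us. a (y # us)) ys"

section \<open>Joins with a vertex\<close>

lemma join_0 [simp]: "join x (\<lambda>_. 0) ws = 0"
  by (induction ws) auto

lemma join_minus: "join x (\<lambda>us. - a us) ws = - join x a ws"
  by (induction ws arbitrary: a) auto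

lemma join_sum: "join x (\<lambda>us. \<Sum>i\<in>I. a i us) ws = (\<Sum>i\<in>I. join x (a i) ws)"
  by (induction ws arbitrary: a) (auto simp: sum_subtractf)

text \<open>After two unfoldings, the head terms of the first two entries trade places with opposite
  signs. The remainder is a join with a double slice of \<open>a\<close>, which changes sign when
  the entries are exchanged and is 0 when they are equal.\<close>

lemma alternating_join:
  assumes "alternating a"
  shows "alternating (join x a)"
proof (rule alternatingI)
  show "join x a (xs @ z # y # ys) = - join x a (xs @ y # z # ys)" for xs y z ys
    using assms
  proof (induction xs arbitrary: a)
    case Nil
    have "(\<lambda>us. a (z # y # us)) = (\<lambda>us. - a (y # z # us))"
      by (intro ext alternating_swap_hd[OF Nil])
    then show ?case by (simp add: join_minus)
  next
    case (Cons w xs)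
    then show ?case
      using Cons.IH[OF alternating_Cons[OF Cons.prems]] alternating_swap[OF Cons.prems, of xs z y]
      by simp
  qed
  show "join x a (xs @ y # y # ys) = 0" for xs y ys
    using assms
  proof (induction xs arbitrary: a)
    case Nil
    have "(\<lambda>us. a (y # y # us)) = (\<lambda>us. 0)"
      using alternating_not_distinct[OF Nil] by auto
    then show ?case by simp
  next
    case (Cons w xs)
    then show ?case
      using Cons.IH[OF alternating_Cons[OF Cons.prems]] alternating_not_distinct[OF Cons.prems]
      by simp
  qed
qed

text \<open>The Leibniz rule for a cone: the omitted vertex is either the apex \<open>x\<close> or a
  vertex of \<open>a\<close>, and in the second case moving it past \<open>x\<close> costs the
  sign.\<close>

lemma bd_join:
  assumes "finite V" "x \<in> V"
  shows "bd V (join x a) ws = a ws - join x (bd V a) ws"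
proof -
  have "bd V (join x a) ws = (\<Sum>v\<in>V. if v = x then a ws else 0) - (\<Sum>v\<in>V. join x (\<lambda>us. a (v # us)) ws)"
    unfolding bd_def sum_subtractf[symmetric] by (intro sum.cong refl) simp
  also have "(\<Sum>v\<in>V. join x (\<lambda>us. a (v # us)) ws) = join x (bd V a) ws"
    unfolding bd_def[abs_def] by (rule join_sum[symmetric])
  finally show ?thesis using assms by simp
qed

text \<open>Bounds the support of a join, so that a filling chain built from joins can be located in
  a complex.\<close>

lemma join_nonzero:
  "join x a ws \<noteq> 0 \<Longrightarrow> \<exists>us. a us \<noteq> 0 \<and> set ws = insert x (set us) \<and> length ws = Suc (length us)"
proof (induction ws arbitrary: a)
  case (Cons y ys)
  show ?case
  proof (cases "y = x \<and> a ys \<noteq> 0")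
    case False
    then have "join x (\<lambda>us. a (y # us)) ys \<noteq> 0" using Cons.prems by (auto split: if_splits)
    from Cons.IH[OF this] obtain us where
      us: "a (y # us) \<noteq> 0" "set ys = insert x (set us)" "length ys = Suc (length us)" by blast
    then show ?thesis by (intro exI[of _ "y # us"]) auto
  qed auto
qed simp

section \<open>Push-forward along a vertex map\<close>

lemma push_0 [simp]: "push V f (\<lambda>_. 0) ws = 0"
  by (induction ws) auto

lemma push_add: "push V f (\<lambda>us. a us + b us) ws = push V f a ws + push V f b ws"
  by (induction ws arbitrary: a b) (auto simp: sum.distrib)

lemma push_scale: "push V f (\<lambda>us. r * a us) ws = r * push V f a ws"
  by (induction ws arbitrary: a) (auto simp: sum_distrib_left)

lemma push_minus: "push V f (\<lambda>us. - a us) ws = - push V f a ws"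
  using push_scale[of V f "-1" a ws] by simp

lemma push_sum: "push V f (\<lambda>us. \<Sum>i\<in>I. a i us) ws = (\<Sum>i\<in>I. push V f (a i) ws)"
proof (induction ws arbitrary: a)
  case (Cons w ws)
  show ?case by (simp add: Cons.IH) (rule sum.swap)
qed simp

lemma push_nonzero: "push V f c ws \<noteq> 0 \<Longrightarrow> \<exists>vs. c vs \<noteq> 0 \<and> map f vs = ws"
proof (induction ws arbitrary: c)
  case (Cons w ws)
  then obtain u where u: "f u = w" "push V f (\<lambda>us. c (u # us)) ws \<noteq> 0"
    by (auto dest: sum.not_neutral_contains_not_neutral)
  from Cons.IH[OF u(2)] obtain vs where "c (u # vs) \<noteq> 0" "map f vs = ws" by blast
  then show ?case using u(1) by (intro exI[of _ "u # vs"]) simp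
qed auto

lemma push_swap_hd:
  assumes "alternating c"
  shows "push V f (\<lambda>us. c (u # v # us)) ws = - push V f (\<lambda>us. c (v # u # us)) ws"
proof -
  have *: "(\<lambda>us. c (u # v # us)) = (\<lambda>us. - c (v # u # us))"
    by (intro ext alternating_swap_hd[OF assms])
  show ?thesis unfolding * by (rule push_minus)
qed

text \<open>Exchanging two adjacent entries exchanges two sums over fibres, and \<open>c\<close>
  supplies the sign. For equal entries both sums run over the same fibre and cancel in pairs, so a
  simplex collapsed by \<open>f\<close> contributes 0.\<close>

lemma alternating_push:
  assumes "finite V" "alternating c"
  shows "alternating (push V f c)"
proof (rule alternatingI)
  show "push V f c (xs @ z # y # ys) = - push V f c (xs @ y # z # ys)" for xs y z ys
    using assms(2)
  proof (induction xs arbitrary: c)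
    case Nil
    have "push V f c (z # y # ys) =
        (\<Sum>u | u \<in> V \<and> f u = z. \<Sum>u' | u' \<in> V \<and> f u' = y. push V f (\<lambda>us. c (u # u' # us)) ys)"
      by simp
    also have "\<dots> =
        (\<Sum>u | u \<in> V \<and> f u = z. \<Sum>u' | u' \<in> V \<and> f u' = y. - push V f (\<lambda>us. c (u' # u # us)) ys)"
      by (intro sum.cong refl push_swap_hd[OF Nil])
    also have "\<dots> = (\<Sum>u' | u' \<in> V \<and> f u' = y. \<Sum>u | u \<in> V \<and> f u = z. - push V f (\<lambda>us. c (u' # u # us)) ys)"
      by (rule sum.swap)
    also have "\<dots> = - push V f c (y # z # ys)" by (simp add: sum_negf)
    finally show ?case by simp
  next
    case (Cons w xs)
    then show ?case by (simp add: alternating_Cons sum_negf)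
  qed
  show "push V f c (xs @ y # y # ys) = 0" for xs y ys
    using assms(2)
  proof (induction xs arbitrary: c)
    case Nil
    have "push V f c (y # y # ys) =
        (\<Sum>u | u \<in> V \<and> f u = y. \<Sum>u' | u' \<in> V \<and> f u' = y. push V f (\<lambda>us. c (u # u' # us)) ys)"
      by simp
    also have "\<dots> = 0"
      using assms(1) alternating_not_distinct[OF Nil]
      by (intro sum_antisymmetric_eq_0 push_swap_hd[OF Nil]) simp_all
    finally show ?case by simp
  next
    case (Cons w xs)
    then show ?case by (simp add: alternating_Cons)
  qed
qed

lemma sum_fibres:
  assumes "finite V" "finite W" "f ` V \<subseteq> W"
  shows "(\<Sum>w\<in>W. \<Sum>u | u \<in> V \<and> f u = w. h u) = (\<Sum>u\<in>V. h u)"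
  by (rule sum.group[OF assms])

text \<open>The fibres over \<open>W\<close> partition \<open>V\<close>, so summing over
  \<open>w\<close> and then over the fibre above \<open>w\<close> is summing over
  \<open>V\<close>.\<close>

lemma bd_push:
  assumes "finite V" "finite W" "f ` V \<subseteq> W"
  shows "bd W (push V f c) ws = push V f (bd V c) ws"
proof -
  have "bd W (push V f c) ws = (\<Sum>u\<in>V. push V f (\<lambda>us. c (u # us)) ws)"
    using sum_fibres[OF assms, of "\<lambda>u. push V f (\<lambda>us. c (u # us)) ws"] by (simp add: bd_def)
  then show ?thesis unfolding bd_def[abs_def] push_sum .
qed

lemma push_push:
  assumes "finite V" "finite W" "f ` V \<subseteq> W"
  shows "push W g (push V f c) ws = push V (\<lambda>x. g (f x)) c ws"
proof (induction ws arbitrary: c)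
  case (Cons z zs)
  let ?h = "\<lambda>u. push V (\<lambda>x. g (f x)) (\<lambda>us. c (u # us)) zs"
  have "push W g (push V f c) (z # zs) = (\<Sum>w | w \<in> W \<and> g w = z. \<Sum>u | u \<in> V \<and> f u = w. ?h u)"
    by (simp add: push_sum Cons.IH)
  \<comment> \<open>If \<open>f u = w\<close> and \<open>g w = z\<close>, then \<open>u\<close> lies
    in the fibre of the composite above \<open>z\<close>; with this restriction
    \<open>sum_fibres\<close> applies.\<close>
  also have "\<dots> = (\<Sum>w | w \<in> W \<and> g w = z. \<Sum>u | u \<in> {u \<in> V. g (f u) = z} \<and> f u = w. ?h u)"
    by (intro sum.cong) auto
  also have "\<dots> = (\<Sum>u | u \<in> V \<and> g (f u) = z. ?h u)"
    using assms by (intro sum_fibres) auto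
  finally show ?case by simp
qed simp

lemma push_join:
  assumes "finite V" "v \<in> V"
  shows "push V f (join v a) ws = join (f v) (push V f a) ws"
proof (induction ws arbitrary: a)
  case (Cons w ws)
  let ?U = "{u. u \<in> V \<and> f u = w}"
  have *: "push V f (\<lambda>us. join v a (u # us)) ws =
      (if u = v then push V f a ws else 0) - join (f v) (push V f (\<lambda>us. a (u # us))) ws" for u
    using push_add[of V f "\<lambda>us. if u = v then a us else 0" "\<lambda>us. - join v (\<lambda>us. a (u # us)) us" ws]
    by (auto simp: push_minus Cons.IH)
  have "push V f (join v a) (w # ws) =
      (\<Sum>u\<in>?U. if u = v then push V f a ws else 0) -
      (\<Sum>u\<in>?U. join (f v) (push V f (\<lambda>us. a (u # us))) ws)"
    by (simp only: push.simps * sum_subtractf)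
  \<comment> \<open>The fibre above \<open>w\<close> contains \<open>v\<close> exactly if
    \<open>w = f v\<close>.\<close>
  also have "(\<Sum>u\<in>?U. if u = v then push V f a ws else 0) = (if w = f v then push V f a ws else 0)"
    using assms by auto
  finally show ?case by (simp add: join_sum)
qed simp

text \<open>The slice of \<open>a\<close> at \<open>v\<close>, the only vertex where the maps may
  differ, is 0. The other slices again vanish on tuples through \<open>v\<close>, so induction
  applies.\<close>

lemma push_eq_off_vertex:
  assumes "finite V" "\<And>us. v \<in> set us \<Longrightarrow> a us = 0" "\<And>u. u \<in> V \<Longrightarrow> u \<noteq> v \<Longrightarrow> f u = g u"
  shows "push V f a ws = push V g a ws"
  using assms(2)
proof (induction ws arbitrary: a)
  case (Cons w ws)
  have "(if f u = w then push V f (\<lambda>us. a (u # us)) ws else 0) =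
        (if g u = w then push V g (\<lambda>us. a (u # us)) ws else 0)" if "u \<in> V" for u
  proof (cases "u = v")
    case True
    then have "(\<lambda>us. a (u # us)) = (\<lambda>_. 0)" using Cons.prems by auto
    then show ?thesis by simp
  next
    case False
    then show ?thesis using Cons assms(3)[OF that False] by simp
  qed
  then show ?case
    using assms(1) by (simp add: sum.inter_filter)
qed simp

section \<open>Homotopy between maps that differ at one vertex\<close>

text \<open>Since \<open>c\<close> vanishes on repetitions, only tuples with a single
  \<open>v\<close> matter. Moving \<open>v\<close> to the front produces the same sign with which
  \<open>join\<close> counts its position, so the signs cancel.\<close>

lemma alternating_join_vertex:
  assumes "alternating c"
  shows "join v (\<lambda>us. c (v # us)) ws = (if v \<in> set ws then c ws else 0)"
  using assms
proof (induction ws arbitrary: c)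
  case (Cons y ys)
  have "(\<lambda>us. c (v # y # us)) = (\<lambda>us. - c (y # v # us))"
    by (intro ext alternating_swap_hd[OF Cons.prems])
  then have "join v (\<lambda>us. c (v # us)) (y # ys) =
      (if y = v then c (v # ys) else 0) + (if v \<in> set ys then c (y # ys) else 0)"
    using Cons.IH[OF alternating_Cons[OF Cons.prems, of y]] by (simp add: join_minus)
  \<comment> \<open>Both summands are present only if \<open>y = v\<close> and \<open>v\<close>
    occurs in \<open>ys\<close>; then \<open>y # ys\<close> has a repetition and \<open>c\<close> is
    0 there.\<close>
  then show ?case using alternating_not_distinct[OF Cons.prems] by auto
qed simp

text \<open>The part of \<open>c\<close> that involves \<open>v\<close> is the join of \<open>v\<close> with \<open>a = c (v # _)\<close>, and \<open>\<partial>a = 0\<close> if \<open>c\<close> is a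
  cycle. The images of \<open>c\<close> under \<open>f\<close> and \<open>g\<close> hence differ by the join of \<open>[f v] - [g v]\<close> with the
  image of \<open>a\<close>, which is the boundary of the join of \<open>[g v, f v]\<close> with it.\<close>

lemma bd_homotopy:
  assumes V: "finite V" "v \<in> V" and W: "finite W" "f ` V \<subseteq> W" "g v \<in> W"
    and c: "alternating c" "\<And>ws. ws \<noteq> [] \<Longrightarrow> bd V c ws = 0"
    and fg: "\<And>u. u \<in> V \<Longrightarrow> u \<noteq> v \<Longrightarrow> f u = g u"
  shows "bd W (join (g v) (join (f v) (push V f (\<lambda>us. c (v # us))))) ws = push V f c ws - push V g c ws"
proof -
  define a where "a = (\<lambda>us. c (v # us))"
  define b where "b = (\<lambda>us. if v \<in> set us then 0 else c us)"
  have c_eq: "c = (\<lambda>us. join v a us + b us)"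
    unfolding a_def b_def by (rule ext) (simp add: alternating_join_vertex[OF c(1)])
  \<comment> \<open>If \<open>v\<close> occurs in \<open>us\<close>, then \<open>v # us\<close> has
    a repetition, so \<open>a\<close> vanishes on tuples through \<open>v\<close>.\<close>
  have "push V f a us = push V g a us" for us
    by (rule push_eq_off_vertex[OF V(1) _ fg]) (auto simp: a_def alternating_not_distinct[OF c(1)])
  then have ga: "push V g a = push V f a" by auto
  have b: "push V f b ws = push V g b ws"
    by (rule push_eq_off_vertex[OF V(1) _ fg]) (auto simp: b_def)
  have split: "push V h c ws = join (h v) (push V h a) ws + push V h b ws" for h :: "'a \<Rightarrow> 'b"
    by (subst c_eq) (simp add: push_add push_join[OF V])
  have "bd V a = (\<lambda>_. 0)"
  proof
    fix us
    \<comment> \<open>The tuple \<open>v # us\<close> is nonempty even for \<open>us = []\<close>,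
      so the cycle condition on nonempty tuples also yields the vanishing of the augmentation of
      \<open>a\<close>.\<close>
    have "bd V a us = - bd V c (v # us)"
      unfolding bd_def a_def unfolding sum_negf[symmetric]
      by (intro sum.cong refl alternating_swap_hd[OF c(1)])
    then show "bd V a us = 0" using c(2) by simp
  qed
  then have "bd W (push V f a) = (\<lambda>_. 0)"
    by (intro ext) (simp add: bd_push[OF V(1) W(1,2)])
  moreover have "f v \<in> W" using V(2) W(2) by auto
  \<comment> \<open>A cone over a cycle has its base as boundary. Applying the Leibniz rule once
    more, to the apex \<open>g v\<close>, leaves the cone with apex \<open>f v\<close> minus the
    cone with apex \<open>g v\<close>.\<close>
  ultimately have "bd W (join (f v) (push V f a)) = push V f a"
    by (auto simp: bd_join[OF W(1)])
  then show ?thesis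
    unfolding split b ga by (simp add: bd_join[OF W(1,3)] flip: a_def)
qed

text \<open>Omitting the same two vertices in the two possible orders gives opposite signs.\<close>

lemma bd_bd:
  assumes "finite V" "alternating c"
  shows "bd V (bd V c) ws = 0"
  unfolding bd_def
  by (intro sum_antisymmetric_eq_0 assms(1) alternating_swap_hd[OF assms(2)])
    (simp add: alternating_not_distinct[OF assms(2)])

section \<open>Chains of simplicial complexes\<close>

text \<open>The vertex set is finite so that \<open>\<Union>K\<close> can serve as the set
  \<open>V\<close> in \<open>bd\<close> and \<open>push\<close>.\<close>

definition simplicial_complex :: "'a set set \<Rightarrow> bool" where
  "simplicial_complex K \<longleftrightarrow> finite (\<Union>K) \<and> {} \<notin> K \<and> (\<forall>\<sigma>\<in>K. \<forall>\<tau>. \<tau> \<subseteq> \<sigma> \<longrightarrow> \<tau> \<noteq> {} \<longrightarrow> \<tau> \<in> K)"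

definition simplicial_map :: "('a \<Rightarrow> 'b) \<Rightarrow> 'a set set \<Rightarrow> 'b set set \<Rightarrow> bool" where
  "simplicial_map f K L \<longleftrightarrow> (\<forall>\<sigma>\<in>K. f ` \<sigma> \<in> L)"

definition contiguous :: "('a \<Rightarrow> 'b) \<Rightarrow> ('a \<Rightarrow> 'b) \<Rightarrow> 'a set set \<Rightarrow> 'b set set \<Rightarrow> bool" where
  "contiguous f g K L \<longleftrightarrow> (\<forall>\<sigma>\<in>K. f ` \<sigma> \<union> g ` \<sigma> \<in> L)"

lemma simplicial_complex_face:
  "simplicial_complex K \<Longrightarrow> \<sigma> \<in> K \<Longrightarrow> \<tau> \<subseteq> \<sigma> \<Longrightarrow> \<tau> \<noteq> {} \<Longrightarrow> \<tau> \<in> K"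
  unfolding simplicial_complex_def by blast

lemma finite_vertices: "simplicial_complex K \<Longrightarrow> finite (\<Union>K)"
  unfolding simplicial_complex_def by blast

lemma simplicial_map_vertices: "simplicial_map f K L \<Longrightarrow> f ` \<Union>K \<subseteq> \<Union>L"
  unfolding simplicial_map_def by blast

lemma contiguous_simplicial_map:
  assumes "simplicial_complex K" "simplicial_complex L" "contiguous f g K L"
  shows "simplicial_map f K L" "simplicial_map g K L"
proof -
  have "f ` \<sigma> \<in> L \<and> g ` \<sigma> \<in> L" if "\<sigma> \<in> K" for \<sigma>
  proof -
    have "\<sigma> \<noteq> {}" using assms(1) that unfolding simplicial_complex_def by blast
    moreover have "f ` \<sigma> \<union> g ` \<sigma> \<in> L" using assms(3) that unfolding contiguous_def by blast
    ultimately show ?thesis using simplicial_complex_face[OF assms(2)] by blast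
  qed
  then show "simplicial_map f K L" "simplicial_map g K L" unfolding simplicial_map_def by auto
qed

lemma boundary_map_eq_bd:
  assumes "finite V" "\<And>vs. c vs \<noteq> 0 \<Longrightarrow> set vs \<subseteq> V"
  shows "boundary_map c ws = (if ws = [] then 0 else bd V c ws)"
proof -
  have "(\<Sum>v | c (v # ws) \<noteq> 0. c (v # ws)) = (\<Sum>v\<in>V. c (v # ws))"
    using assms(1) assms(2)[of "_ # ws"] by (intro sum.mono_neutral_left) auto
  then show ?thesis by (simp add: boundary_map_def bd_def)
qed

text \<open>The tuples above \<open>w # ws\<close> are split by their first vertex. The sums are
  finite because the length is fixed by the target tuple and the entries lie in
  \<open>V\<close>.\<close>

lemma chain_map_eq_push:
  assumes "finite V" "\<And>vs. c vs \<noteq> 0 \<Longrightarrow> set vs \<subseteq> V"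
  shows "chain_map f c ws = push V f c ws"
  using assms(2)
proof (induction ws arbitrary: c)
  case Nil
  have "{vs. c vs \<noteq> 0 \<and> map f vs = []} = (if c [] = 0 then {} else {[]})" by auto
  then show ?case by (simp add: chain_map_def)
next
  case (Cons w ws)
  let ?U = "{u. u \<in> V \<and> f u = w}" and ?S = "\<lambda>u. {us. c (u # us) \<noteq> 0 \<and> map f us = ws}"
  have supp: "set us \<subseteq> V" if "c (u # us) \<noteq> 0" for u us
    using Cons.prems[OF that] by simp
  have fin: "finite ((#) u ` ?S u)" for u
  proof (rule finite_imageI, rule finite_subset)
    show "?S u \<subseteq> {us. set us \<subseteq> V \<and> length us = length ws}" using supp by auto
  qed (rule finite_lists_length_eq[OF assms(1)])
  have "{vs. c vs \<noteq> 0 \<and> map f vs = w # ws} = (\<Union>u\<in>?U. (#) u ` ?S u)"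
    using Cons.prems by (fastforce simp: map_eq_Cons_conv)
  then have "chain_map f c (w # ws) = (\<Sum>vs\<in>(\<Union>u\<in>?U. (#) u ` ?S u). c vs)"
    by (simp add: chain_map_def)
  also have "\<dots> = (\<Sum>u\<in>?U. \<Sum>vs\<in>(#) u ` ?S u. c vs)"
    by (rule sum.UNION_disjoint) (use assms(1) fin in auto)
  also have "\<dots> = (\<Sum>u\<in>?U. chain_map f (\<lambda>us. c (u # us)) ws)"
    by (intro sum.cong refl) (simp add: sum.reindex chain_map_def)
  also have "\<dots> = push V f c (w # ws)"
    using Cons.IH[OF supp] by simp
  finally show ?case .
qed

lemma oriented_chainsD:
  assumes "simplicial_complex K" "c \<in> oriented_chains K p"
  shows "alternating c" "\<And>vs. c vs \<noteq> 0 \<Longrightarrow> length vs = Suc p \<and> set vs \<in> K"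
    "\<And>vs. c vs \<noteq> 0 \<Longrightarrow> set vs \<subseteq> \<Union>K"
proof -
  note c = assms(2)[unfolded oriented_chains_def mem_Collect_eq, THEN conjunct2]
  note supp = c[THEN conjunct1] and swap = c[THEN conjunct2]
  have "\<forall>vs. \<not> distinct vs \<longrightarrow> c vs = 0" using supp by blast
  with swap show "alternating c" unfolding alternating_def by (rule conjI)
  show "length vs = Suc p \<and> set vs \<in> K" "set vs \<subseteq> \<Union>K" if "c vs \<noteq> 0" for vs
    using supp that by blast+
qed

lemma oriented_chainsI:
  assumes "simplicial_complex K" "alternating c"
    "\<And>vs. c vs \<noteq> 0 \<Longrightarrow> length vs = Suc p \<and> set vs \<in> K"
  shows "c \<in> oriented_chains K p"
proof -
  have "{vs. c vs \<noteq> 0} \<subseteq> {vs. set vs \<subseteq> \<Union>K \<and> length vs = Suc p}"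
    using assms(3) by blast
  then have "finite {vs. c vs \<noteq> 0}"
    using finite_subset finite_lists_length_eq[OF finite_vertices[OF assms(1)]] by blast
  moreover have "\<forall>vs. c vs \<noteq> 0 \<longrightarrow> distinct vs \<and> length vs = Suc p \<and> set vs \<in> K"
    using assms(3) alternating_not_distinct[OF assms(2)] by blast
  moreover have "\<forall>xs x y ys. c (xs @ y # x # ys) = - c (xs @ x # y # ys)"
    using assms(2) unfolding alternating_def by (rule conjunct1)
  ultimately show ?thesis
    unfolding oriented_chains_def mem_Collect_eq by (intro conjI)
qed

section \<open>The boundary operator, cycles and boundaries\<close>

lemma boundary_map_chain:
  assumes "simplicial_complex K" "c \<in> oriented_chains K p"
  shows "boundary_map c ws = (if ws = [] then 0 else bd (\<Union>K) c ws)"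
  using oriented_chainsD(3)[OF assms] by (intro boundary_map_eq_bd finite_vertices assms(1)) blast

lemma chain_map_chain:
  assumes "simplicial_complex K" "c \<in> oriented_chains K p"
  shows "chain_map f c ws = push (\<Union>K) f c ws"
  using oriented_chainsD(3)[OF assms] by (intro chain_map_eq_push finite_vertices assms(1)) blast

text \<open>A chain of positive degree vanishes on 1-tuples, so its augmentation is 0 and the two
  operators agree at \<open>[]\<close> too.\<close>

lemma boundary_map_chain_Suc:
  assumes "simplicial_complex K" "c \<in> oriented_chains K (Suc p)"
  shows "boundary_map c = bd (\<Union>K) c"
proof
  fix ws
  have "c [v] = 0" for v using oriented_chainsD(2)[OF assms, of "[v]"] by auto
  then show "boundary_map c ws = bd (\<Union>K) c ws"
    by (simp add: boundary_map_chain[OF assms] bd_def)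
qed

lemma alternating_bd:
  assumes "alternating c"
  shows "alternating (bd V c)"
proof (rule alternatingI)
  show "bd V c (xs @ y # x # ys) = - bd V c (xs @ x # y # ys)" for xs x y ys
    unfolding bd_def sum_negf[symmetric]
    by (intro sum.cong refl alternating_swap[OF alternating_Cons[OF assms]])
  show "bd V c (xs @ x # x # ys) = 0" for xs x ys
    using alternating_not_distinct[OF assms] by (simp add: bd_def)
qed

lemma boundary_map_in_chains:
  assumes "simplicial_complex K" "c \<in> oriented_chains K (Suc p)"
  shows "boundary_map c \<in> oriented_chains K p"
  unfolding boundary_map_chain_Suc[OF assms]
proof (rule oriented_chainsI[OF assms(1)])
  show "alternating (bd (\<Union>K) c)" by (intro alternating_bd oriented_chainsD(1)[OF assms])
  fix vs assume "bd (\<Union>K) c vs \<noteq> 0"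
  then obtain v where "c (v # vs) \<noteq> 0"
    unfolding bd_def by (rule sum.not_neutral_contains_not_neutral)
  from oriented_chainsD(2)[OF assms, OF this] have "length vs = Suc p" "insert v (set vs) \<in> K" by auto
  \<comment> \<open>The length \<open>Suc p\<close> makes \<open>vs\<close> nonempty, so its entries
    form a face.\<close>
  then show "length vs = Suc p \<and> set vs \<in> K"
    using simplicial_complex_face[OF assms(1), of "insert v (set vs)" "set vs"] by (cases vs) auto
qed

lemma boundaries_subset_cycles:
  assumes "simplicial_complex K"
  shows "boundaries K p \<subseteq> cycles K p"
proof -
  have "boundary_map (boundary_map c) = (\<lambda>_. 0)" if c: "c \<in> oriented_chains K (Suc p)"
    for c :: "'a list \<Rightarrow> 'k::field"
  proof
    fix ws
    show "boundary_map (boundary_map c) ws = 0"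
      using bd_bd[OF finite_vertices[OF assms] oriented_chainsD(1)[OF assms c]]
        boundary_map_chain[OF assms boundary_map_in_chains[OF assms c], of ws]
      by (simp add: boundary_map_chain_Suc[OF assms c])
  qed
  then show ?thesis
    using boundary_map_in_chains[OF assms] unfolding boundaries_def cycles_def by auto
qed

section \<open>Chain maps induced by simplicial maps\<close>

lemma chain_map_in_chains:
  assumes "simplicial_complex K" "simplicial_complex L" "simplicial_map f K L"
    and c: "c \<in> oriented_chains K p"
  shows "chain_map f c \<in> oriented_chains L p"
proof (rule oriented_chainsI[OF assms(2)])
  have eq: "chain_map f c = push (\<Union>K) f c" using chain_map_chain[OF assms(1) c] by (rule ext)
  show "alternating (chain_map f c)"
    unfolding eq by (intro alternating_push finite_vertices assms(1) oriented_chainsD(1)[OF assms(1) c])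
  fix ws assume "chain_map f c ws \<noteq> 0"
  then obtain vs where "c vs \<noteq> 0" "map f vs = ws" unfolding eq using push_nonzero by blast
  then show "length ws = Suc p \<and> set ws \<in> L"
    using oriented_chainsD(2)[OF assms(1) c, of vs] assms(3) unfolding simplicial_map_def by auto
qed

lemma boundary_map_chain_map:
  assumes "simplicial_complex K" "simplicial_complex L" "simplicial_map f K L"
    and c: "c \<in> oriented_chains K p" and "ws \<noteq> []"
  shows "boundary_map (chain_map f c) ws = push (\<Union>K) f (bd (\<Union>K) c) ws"
proof -
  have "chain_map f c = push (\<Union>K) f c" using chain_map_chain[OF assms(1) c] by (rule ext)
  then show ?thesis
    using boundary_map_chain[OF assms(2) chain_map_in_chains[OF assms(1-3) c], of ws] assms(5)
      bd_push[OF finite_vertices[OF assms(1)] finite_vertices[OF assms(2)]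
        simplicial_map_vertices[OF assms(3)]]
    by simp
qed

lemma cyclesD:
  assumes "simplicial_complex K" "c \<in> cycles K p"
  shows "c \<in> oriented_chains K p" "ws \<noteq> [] \<Longrightarrow> bd (\<Union>K) c ws = 0"
proof -
  show c: "c \<in> oriented_chains K p" using assms(2) by (simp add: cycles_def)
  assume "ws \<noteq> []"
  then show "bd (\<Union>K) c ws = 0"
    using boundary_map_chain[OF assms(1) c, of ws] assms(2) by (simp add: cycles_def)
qed

lemma chain_map_cycles:
  assumes "simplicial_complex K" "simplicial_complex L" "simplicial_map f K L"
    and "c \<in> cycles K p"
  shows "chain_map f c \<in> cycles L p"
proof -
  note c = cyclesD[OF assms(1,4)]
  have "boundary_map (chain_map f c) ws = 0" for ws
  proof (cases "ws = []")
    case False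
    \<comment> \<open>For a 0-cycle the augmentation \<open>bd (\<Union>K) c []\<close> may be
      nonzero. As \<open>push\<close> preserves lengths, that value cannot reach the nonempty tuple
      \<open>ws\<close>.\<close>
    have "push (\<Union>K) f (bd (\<Union>K) c) ws = 0"
    proof (rule ccontr)
      assume "push (\<Union>K) f (bd (\<Union>K) c) ws \<noteq> 0"
      then obtain vs where "bd (\<Union>K) c vs \<noteq> 0" "map f vs = ws" using push_nonzero by blast
      then show False using c(2)[of vs] False by auto
    qed
    then show ?thesis using boundary_map_chain_map[OF assms(1-3) c(1) False] by simp
  qed (simp add: boundary_map_def)
  then show ?thesis
    using chain_map_in_chains[OF assms(1-3) c(1)] unfolding cycles_def by auto
qed

lemma chain_map_boundaries:
  assumes "simplicial_complex K" "simplicial_complex L" "simplicial_map f K L"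
    and "b \<in> boundaries K p"
  shows "chain_map f b \<in> boundaries L p"
proof -
  obtain c where c: "c \<in> oriented_chains K (Suc p)" "b = boundary_map c"
    using assms(4) unfolding boundaries_def by blast
  have fc: "chain_map f c \<in> oriented_chains L (Suc p)" by (rule chain_map_in_chains[OF assms(1-3) c(1)])
  have "chain_map f b ws = boundary_map (chain_map f c) ws" for ws
  proof -
    have eq: "chain_map f c = push (\<Union>K) f c" using chain_map_chain[OF assms(1) c(1)] by (rule ext)
    have "boundary_map (chain_map f c) ws = push (\<Union>K) f (bd (\<Union>K) c) ws"
      using boundary_map_chain_Suc[OF assms(2) fc]
        bd_push[OF finite_vertices[OF assms(1)] finite_vertices[OF assms(2)]
          simplicial_map_vertices[OF assms(3)]] by (simp add: eq)
    then show ?thesis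
      using chain_map_chain[OF assms(1) boundary_map_in_chains[OF assms(1) c(1)], of f ws]
        boundary_map_chain_Suc[OF assms(1) c(1)] c(2) by simp
  qed
  then have "chain_map f b = boundary_map (chain_map f c)" by (rule ext)
  then show ?thesis using fc unfolding boundaries_def by blast
qed

lemma chain_map_comp:
  assumes "simplicial_complex K" "simplicial_complex L" "simplicial_map f K L"
    and "c \<in> oriented_chains K p"
  shows "chain_map g (chain_map f c) = chain_map (\<lambda>x. g (f x)) c"
proof
  fix ws
  have eq: "chain_map f c = push (\<Union>K) f c" using chain_map_chain[OF assms(1,4)] by (rule ext)
  show "chain_map g (chain_map f c) ws = chain_map (\<lambda>x. g (f x)) c ws"
    using chain_map_chain[OF assms(2) chain_map_in_chains[OF assms], of g ws]
      chain_map_chain[OF assms(1,4), of "\<lambda>x. g (f x)" ws]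
      push_push[OF finite_vertices[OF assms(1)] finite_vertices[OF assms(2)]
        simplicial_map_vertices[OF assms(3)]]
    by (simp add: eq)
qed

lemma chain_map_id: "chain_map (\<lambda>x. x) c = c"
proof
  fix ws
  have "{vs. c vs \<noteq> 0 \<and> map (\<lambda>x. x) vs = ws} = (if c ws = 0 then {} else {ws})" by auto
  then show "chain_map (\<lambda>x. x) c ws = c ws" by (simp add: chain_map_def)
qed

section \<open>Linear combinations of chains, cycles and boundaries\<close>

lemma zero_chain: "(\<lambda>_. 0) \<in> oriented_chains K p"
  by (simp add: oriented_chains_def)

text \<open>Two coefficients are carried along so that sums and scalar multiples are instances of
  the same statements.\<close>

lemma alternating_linear:
  assumes "alternating a" "alternating b"
  shows "alternating (\<lambda>vs. r * a vs + s * b vs)"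
proof (rule alternatingI)
  show "r * a (xs @ y # x # ys) + s * b (xs @ y # x # ys) = - (r * a (xs @ x # y # ys) + s * b (xs @ x # y # ys))"
    for xs x y ys
    unfolding alternating_swap[OF assms(1), of xs y x ys] alternating_swap[OF assms(2), of xs y x ys]
    by simp
qed (simp add: alternating_not_distinct[OF assms(1)] alternating_not_distinct[OF assms(2)])

lemma linear_chain:
  assumes "simplicial_complex K" "a \<in> oriented_chains K p" "b \<in> oriented_chains K p"
  shows "(\<lambda>vs. r * a vs + s * b vs) \<in> oriented_chains K p"
proof (rule oriented_chainsI[OF assms(1)])
  show "alternating (\<lambda>vs. r * a vs + s * b vs)"
    by (intro alternating_linear oriented_chainsD(1)[OF assms(1,2)] oriented_chainsD(1)[OF assms(1,3)])
  fix vs assume "r * a vs + s * b vs \<noteq> 0"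
  then have "a vs \<noteq> 0 \<or> b vs \<noteq> 0" by auto
  then show "length vs = Suc p \<and> set vs \<in> K"
    using oriented_chainsD(2)[OF assms(1,2)] oriented_chainsD(2)[OF assms(1,3)] by blast
qed

lemma boundary_map_linear:
  assumes "simplicial_complex K" "a \<in> oriented_chains K p" "b \<in> oriented_chains K p"
  shows "boundary_map (\<lambda>vs. r * a vs + s * b vs) = (\<lambda>vs. r * boundary_map a vs + s * boundary_map b vs)"
  by (rule ext) (simp add: boundary_map_chain[OF assms(1) assms(2)] boundary_map_chain[OF assms(1) assms(3)]
    boundary_map_chain[OF assms(1) linear_chain[OF assms]] bd_def sum.distrib sum_distrib_left)

lemma chain_map_linear:
  assumes "simplicial_complex K" "a \<in> oriented_chains K p" "b \<in> oriented_chains K p"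
  shows "chain_map f (\<lambda>vs. r * a vs + s * b vs) = (\<lambda>vs. r * chain_map f a vs + s * chain_map f b vs)"
  by (rule ext) (simp add: chain_map_chain[OF assms(1) assms(2)] chain_map_chain[OF assms(1) assms(3)]
    chain_map_chain[OF assms(1) linear_chain[OF assms]] push_add push_scale)

lemma linear_cycle:
  assumes "simplicial_complex K" "a \<in> cycles K p" "b \<in> cycles K p"
  shows "(\<lambda>vs. r * a vs + s * b vs) \<in> cycles K p"
proof -
  have a: "a \<in> oriented_chains K p" "boundary_map a = (\<lambda>_. 0)"
    and b: "b \<in> oriented_chains K p" "boundary_map b = (\<lambda>_. 0)"
    using assms(2,3) unfolding cycles_def by blast+
  have "boundary_map (\<lambda>vs. r * a vs + s * b vs) = (\<lambda>_. 0)"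
    unfolding boundary_map_linear[OF assms(1) a(1) b(1)] a(2) b(2) by simp
  then show ?thesis using linear_chain[OF assms(1) a(1) b(1)] unfolding cycles_def by blast
qed

lemma linear_boundary:
  assumes "simplicial_complex K" "a \<in> boundaries K p" "b \<in> boundaries K p"
  shows "(\<lambda>vs. r * a vs + s * b vs) \<in> boundaries K p"
proof -
  obtain a' b' where a': "a' \<in> oriented_chains K (Suc p)" "a = boundary_map a'"
    and b': "b' \<in> oriented_chains K (Suc p)" "b = boundary_map b'"
    using assms(2,3) unfolding boundaries_def by blast
  show ?thesis
    unfolding a'(2) b'(2) boundary_map_linear[OF assms(1) a'(1) b'(1), symmetric] boundaries_def
    by (intro imageI linear_chain assms(1) a'(1) b'(1))
qed

lemma zero_boundary: "(\<lambda>_. 0) \<in> boundaries K p"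
  unfolding boundaries_def
  by (rule image_eqI[OF _ zero_chain]) (rule ext, simp add: boundary_map_def)

subsection \<open>Contiguous maps\<close>

text \<open>The filling chain of \<open>bd_homotopy\<close> is supported on subsets of
  \<open>f\<close> \<sigma> \<union> g \<open>\<sigma>\<close> for simplices \<sigma> of
  \<open>K\<close> through \<open>v\<close>, and contiguity puts these into
  \<open>L\<close>.\<close>

lemma contiguous_vertex_homologous:
  assumes K: "simplicial_complex K" and L: "simplicial_complex L" and cont: "contiguous f g K L"
    and v: "v \<in> \<Union>K" and fg: "\<And>u. u \<noteq> v \<Longrightarrow> f u = g u"
    and z: "z \<in> cycles K p"
  shows "(\<lambda>ws. chain_map f z ws - chain_map g z ws) \<in> boundaries L p"
proof -
  note z' = cyclesD[OF K z]
  note f = contiguous_simplicial_map(1)[OF K L cont] and g = contiguous_simplicial_map(2)[OF K L cont]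
  have alt: "alternating z" by (rule oriented_chainsD(1)[OF K z'(1)])
  \<comment> \<open>The image of the link part of \<open>z\<close> at \<open>v\<close>;
    \<open>H\<close> joins it with both images of \<open>v\<close>. Being alternating,
    \<open>H\<close> is 0 on tuples with a repetition, so \<open>f v = g v\<close> needs no separate
    case.\<close>
  define A where "A = push (\<Union>K) f (\<lambda>us. z (v # us))"
  define H where "H = join (g v) (join (f v) A)"
  have H: "H \<in> oriented_chains L (Suc p)"
  proof (rule oriented_chainsI[OF L])
    show "alternating H"
      unfolding H_def A_def
      by (intro alternating_join alternating_push finite_vertices[OF K] alternating_Cons[OF alt])
    fix ws assume "H ws \<noteq> 0"
    from join_nonzero[OF this[unfolded H_def]]
    obtain us where us: "join (f v) A us \<noteq> 0" "set ws = insert (g v) (set us)" "length ws = Suc (length us)"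
      by (elim exE conjE)
    from join_nonzero[OF us(1)]
    obtain xs where xs: "A xs \<noteq> 0" "set us = insert (f v) (set xs)" "length us = Suc (length xs)"
      by (elim exE conjE)
    from push_nonzero[OF xs(1)[unfolded A_def]]
    obtain vs where vs: "z (v # vs) \<noteq> 0" "map f vs = xs" by (elim exE conjE)
    \<comment> \<open>The slice at \<open>v\<close> has one entry fewer than \<open>z\<close>, and
      the two joins add two, so \<open>H\<close> has degree \<open>Suc p\<close>.\<close>
    have \<sigma>: "length vs = p" "insert v (set vs) \<in> K"
      using oriented_chainsD(2)[OF K z'(1), OF vs(1)] by auto
    then have "f ` insert v (set vs) \<union> g ` insert v (set vs) \<in> L" using cont unfolding contiguous_def by blast
    moreover have "set ws \<subseteq> f ` insert v (set vs) \<union> g ` insert v (set vs)"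
      using us(2) xs(2) vs(2) by auto
    moreover have "set ws \<noteq> {}" using us(2) by simp
    ultimately have "set ws \<in> L" by (rule simplicial_complex_face[OF L])
    then show "length ws = Suc (Suc p) \<and> set ws \<in> L" using us(3) xs(3) vs(2) \<sigma>(1) by auto
  qed
  have "boundary_map H ws = chain_map f z ws - chain_map g z ws" for ws
  proof -
    have "bd (\<Union>L) H ws = push (\<Union>K) f z ws - push (\<Union>K) g z ws"
      unfolding H_def A_def
    proof (rule bd_homotopy)
      show "g v \<in> \<Union>L" using simplicial_map_vertices[OF g] v by blast
      show "bd (\<Union>K) z us = 0" if "us \<noteq> []" for us by (rule z'(2)[OF that])
      show "f u = g u" if "u \<in> \<Union>K" "u \<noteq> v" for u by (rule fg[OF that(2)])
    qed (fact finite_vertices[OF K] finite_vertices[OF L] v alt simplicial_map_vertices[OF f])+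
    then show ?thesis
      by (simp add: boundary_map_chain_Suc[OF L H] chain_map_chain[OF K z'(1)])
  qed
  then have "(\<lambda>ws. chain_map f z ws - chain_map g z ws) = boundary_map H" by (intro ext) (rule sym)
  then show ?thesis unfolding boundaries_def by (rule image_eqI[OF _ H])
qed

lemma contiguous_homologous:
  assumes K: "simplicial_complex K" and L: "simplicial_complex L" and cont: "contiguous f g K L"
    and z: "z \<in> cycles K p"
  shows "(\<lambda>ws. chain_map f z ws - chain_map g z ws) \<in> boundaries L p"
proof -
  \<comment> \<open>The maps \<open>h S\<close> interpolate from \<open>f\<close> at the empty set
    to \<open>g\<close> on all vertices; each insertion changes the value at one vertex
    only.\<close>
  define h where "h S x = (if x \<in> S then g x else f x)" for S x
  have "(\<lambda>ws. chain_map f z ws - chain_map (h S) z ws) \<in> boundaries L p" if "finite S" "S \<subseteq> \<Union>K" for S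
    using that
  proof (induction S)
    case empty
    have "h {} = f" by (auto simp: h_def)
    then show ?case using zero_boundary by simp
  next
    case (insert v S)
    have "contiguous (h S) (h (insert v S)) K L"
      unfolding contiguous_def
    proof
      fix \<sigma> assume \<sigma>: "\<sigma> \<in> K"
      have "h S ` \<sigma> \<union> h (insert v S) ` \<sigma> \<subseteq> f ` \<sigma> \<union> g ` \<sigma>" by (auto simp: h_def)
      moreover have "\<sigma> \<noteq> {}" using K \<sigma> unfolding simplicial_complex_def by blast
      moreover have "f ` \<sigma> \<union> g ` \<sigma> \<in> L" using cont \<sigma> unfolding contiguous_def by blast
      ultimately show "h S ` \<sigma> \<union> h (insert v S) ` \<sigma> \<in> L" using simplicial_complex_face[OF L] by blast
    qed
    then have "(\<lambda>ws. chain_map (h S) z ws - chain_map (h (insert v S)) z ws) \<in> boundaries L p"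
      by (rule contiguous_vertex_homologous[OF K L _ _ _ z, where v = v])
        (use insert.prems in \<open>auto simp: h_def\<close>)
    \<comment> \<open>The two differences telescope.\<close>
    from linear_boundary[OF L insert.IH this, of 1 1] show ?case using insert.prems by simp
  qed
  from this[OF finite_vertices[OF K] order_refl]
  have "(\<lambda>ws. chain_map f z ws - chain_map (h (\<Union>K)) z ws) \<in> boundaries L p" .
  \<comment> \<open>Outside \<open>\<Union>K\<close> the map \<open>h (\<Union>K)\<close> is still
    \<open>f\<close>, but the support of \<open>z\<close> has its entries in
    \<open>\<Union>K\<close>.\<close>
  moreover have "chain_map (h (\<Union>K)) z = chain_map g z"
  proof
    fix ws
    have "map (h (\<Union>K)) vs = map g vs" if "z vs \<noteq> 0" for vs
      using oriented_chainsD(3)[OF K cyclesD(1)[OF K z], OF that] by (auto simp: h_def)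
    then have "{vs. z vs \<noteq> 0 \<and> map (h (\<Union>K)) vs = ws} = {vs. z vs \<noteq> 0 \<and> map g vs = ws}" by auto
    then show "chain_map (h (\<Union>K)) z ws = chain_map g z ws" by (simp add: chain_map_def)
  qed
  ultimately show ?thesis by simp
qed

section \<open>Homology\<close>

text \<open>The scalar multiple is defined as a union over all representatives. As \<open>B\<close>
  is stable under scalars, every representative yields the same coset.\<close>

lemma quotient_space_smult:
  assumes "Module.module class_ring V" "abelian_subgroup B V" "\<And>a b. b \<in> B \<Longrightarrow> a \<odot>\<^bsub>V\<^esub> b \<in> B"
    and x: "x \<in> carrier V"
  shows "a \<odot>\<^bsub>quotient_space V B\<^esub> (B +>\<^bsub>V\<^esub> x) = B +>\<^bsub>V\<^esub> (a \<odot>\<^bsub>V\<^esub> x)"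
proof -
  interpret Module.module class_ring V by fact
  interpret B: abelian_subgroup B V by fact
  have "B +>\<^bsub>V\<^esub> (a \<odot>\<^bsub>V\<^esub> c) = B +>\<^bsub>V\<^esub> (a \<odot>\<^bsub>V\<^esub> x)" if "c \<in> B +>\<^bsub>V\<^esub> x" for c
  proof -
    obtain b where b: "b \<in> B" "c = b \<oplus>\<^bsub>V\<^esub> x"
      using \<open>c \<in> B +>\<^bsub>V\<^esub> x\<close> unfolding a_r_coset_def' by blast
    have "a \<odot>\<^bsub>V\<^esub> c = (a \<odot>\<^bsub>V\<^esub> b) \<oplus>\<^bsub>V\<^esub> (a \<odot>\<^bsub>V\<^esub> x)"
      unfolding b(2) using smult_r_distr[of a b x] b(1) x by simp
    then have "a \<odot>\<^bsub>V\<^esub> c \<in> B +>\<^bsub>V\<^esub> (a \<odot>\<^bsub>V\<^esub> x)"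
      using assms(3)[OF b(1)] unfolding a_r_coset_def' by blast
    moreover have "a \<odot>\<^bsub>V\<^esub> x \<in> carrier V" using x by simp
    ultimately show ?thesis using B.a_repr_independence' by metis
  qed
  moreover have "x \<in> B +>\<^bsub>V\<^esub> x" using x by (rule B.a_rcos_self)
  ultimately have "(\<Union>c\<in>B +>\<^bsub>V\<^esub> x. B +>\<^bsub>V\<^esub> (a \<odot>\<^bsub>V\<^esub> c)) = B +>\<^bsub>V\<^esub> (a \<odot>\<^bsub>V\<^esub> x)" by blast
  then show ?thesis by (simp add: quotient_space_def)
qed

lemma quotient_space_add:
  assumes "abelian_subgroup B V" "x \<in> carrier V" "y \<in> carrier V"
  shows "(B +>\<^bsub>V\<^esub> x) \<oplus>\<^bsub>quotient_space V B\<^esub> (B +>\<^bsub>V\<^esub> y) = B +>\<^bsub>V\<^esub> (x \<oplus>\<^bsub>V\<^esub> y)"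
  using abelian_subgroup.a_rcos_sum[OF assms] by (simp add: quotient_space_def)

lemma quotient_space_carrier: "carrier (quotient_space V B) = (\<lambda>x. B +>\<^bsub>V\<^esub> x) ` carrier V"
  by (auto simp: quotient_space_def A_RCOSETS_defs a_r_coset_def)

lemma vectorspace_quotient_space:
  fixes V :: "('k::field, 'v) module"
  assumes "vectorspace class_ring V" "abelian_subgroup B V" "\<And>a b. b \<in> B \<Longrightarrow> a \<odot>\<^bsub>V\<^esub> b \<in> B"
  shows "vectorspace class_ring (quotient_space V B)"
proof -
  interpret V: vectorspace class_ring V by fact
  interpret B: abelian_subgroup B V by fact
  let ?Q = "quotient_space V B"
  have mod: "Module.module class_ring V" ..
  note smult = quotient_space_smult[OF mod assms(2,3)] and add = quotient_space_add[OF assms(2)]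
  \<comment> \<open>With the zero \<open>B\<close> written as a coset, all axioms can be checked on
    representatives.\<close>
  have zero: "\<zero>\<^bsub>?Q\<^esub> = B +>\<^bsub>V\<^esub> \<zero>\<^bsub>V\<^esub>"
    using B.a_rcos_const[of "\<zero>\<^bsub>V\<^esub>"] by (simp add: quotient_space_def)
  have distr: "(a + b) \<odot>\<^bsub>V\<^esub> x = a \<odot>\<^bsub>V\<^esub> x \<oplus>\<^bsub>V\<^esub> b \<odot>\<^bsub>V\<^esub> x"
    "a \<odot>\<^bsub>V\<^esub> (x \<oplus>\<^bsub>V\<^esub> y) = a \<odot>\<^bsub>V\<^esub> x \<oplus>\<^bsub>V\<^esub> a \<odot>\<^bsub>V\<^esub> y"
    "(a * b) \<odot>\<^bsub>V\<^esub> x = a \<odot>\<^bsub>V\<^esub> (b \<odot>\<^bsub>V\<^esub> x)" "1 \<odot>\<^bsub>V\<^esub> x = x" "a \<odot>\<^bsub>V\<^esub> x \<in> carrier V"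
    if "x \<in> carrier V" "y \<in> carrier V" for a b :: 'k and x y
    using that V.smult_l_distr[of a b x] V.smult_r_distr[of a x y] V.smult_assoc1[of a b x]
      V.smult_one[of x] V.smult_closed[of a x] by simp_all
  have "abelian_group ?Q"
  proof (rule abelian_groupI)
    fix C assume "C \<in> carrier ?Q"
    then obtain x where x: "x \<in> carrier V" "C = B +>\<^bsub>V\<^esub> x" unfolding quotient_space_carrier by blast
    have "B +>\<^bsub>V\<^esub> (\<ominus>\<^bsub>V\<^esub> x) \<in> carrier ?Q" using x(1) by (simp add: quotient_space_carrier)
    moreover have "(B +>\<^bsub>V\<^esub> (\<ominus>\<^bsub>V\<^esub> x)) \<oplus>\<^bsub>?Q\<^esub> C = \<zero>\<^bsub>?Q\<^esub>"
      using x(1) by (simp add: x(2) add zero V.l_neg)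
    ultimately show "\<exists>D\<in>carrier ?Q. D \<oplus>\<^bsub>?Q\<^esub> C = \<zero>\<^bsub>?Q\<^esub>" by blast
  qed (unfold quotient_space_carrier zero, ((elim imageE)?, simp add: add V.a_ac)+)
  then have "Module.module class_ring ?Q"
    by (rule moduleI[OF class_cring.cring_axioms])
      (unfold quotient_space_carrier, ((elim imageE)?, simp add: smult add distr)+)
  then show ?thesis by (rule vectorspace.intro[OF _ class_field])
qed

section \<open>Homology as a vector space\<close>

definition cycle_space :: "'a set set \<Rightarrow> nat \<Rightarrow> ('k::field, 'a list \<Rightarrow> 'k) module" where
  "cycle_space K p = (chain_space K p)\<lparr>carrier := cycles K p\<rparr>"

lemma cycle_space_simps [simp]:
  "carrier (cycle_space K p) = cycles K p"
  "\<zero>\<^bsub>cycle_space K p\<^esub> = (\<lambda>_. 0)"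
  "a \<oplus>\<^bsub>cycle_space K p\<^esub> b = (\<lambda>vs. a vs + b vs)"
  "r \<odot>\<^bsub>cycle_space K p\<^esub> a = (\<lambda>vs. r * a vs)"
  by (simp_all add: cycle_space_def chain_space_def)

lemma add_cycle: "simplicial_complex K \<Longrightarrow> a \<in> cycles K p \<Longrightarrow> b \<in> cycles K p \<Longrightarrow> (\<lambda>vs. a vs + b vs) \<in> cycles K p"
  using linear_cycle[of K a p b 1 1] by simp

lemma scale_cycle: "simplicial_complex K \<Longrightarrow> a \<in> cycles K p \<Longrightarrow> (\<lambda>vs. r * a vs) \<in> cycles K p"
  using linear_cycle[of K a p a r 0] by simp

lemma add_boundary: "simplicial_complex K \<Longrightarrow> a \<in> boundaries K p \<Longrightarrow> b \<in> boundaries K p \<Longrightarrow> (\<lambda>vs. a vs + b vs) \<in> boundaries K p"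
  using linear_boundary[of K a p b 1 1] by simp

lemma scale_boundary: "simplicial_complex K \<Longrightarrow> a \<in> boundaries K p \<Longrightarrow> (\<lambda>vs. r * a vs) \<in> boundaries K p"
  using linear_boundary[of K a p a r 0] by simp

lemma vectorspace_cycle_space:
  assumes K: "simplicial_complex K"
  shows "vectorspace class_ring (cycle_space K p :: ('k::field, 'a list \<Rightarrow> 'k) module)"
proof -
  let ?Z = "cycle_space K p :: ('k, 'a list \<Rightarrow> 'k) module"
  have "abelian_group ?Z"
  proof (rule abelian_groupI)
    show "\<zero>\<^bsub>?Z\<^esub> \<in> carrier ?Z" using subsetD[OF boundaries_subset_cycles[OF K] zero_boundary] by simp
    fix a assume "a \<in> carrier ?Z"
    then have "(\<lambda>vs. - a vs) \<in> cycles K p" using scale_cycle[OF K, of a p "-1"] by simp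
    then show "\<exists>b\<in>carrier ?Z. b \<oplus>\<^bsub>?Z\<^esub> a = \<zero>\<^bsub>?Z\<^esub>" by (intro bexI[of _ "\<lambda>vs. - a vs"]) simp_all
  qed (simp_all add: add_cycle[OF K] ac_simps)
  then have "Module.module class_ring ?Z"
    by (rule moduleI[OF class_cring.cring_axioms])
      (simp_all add: scale_cycle[OF K] distrib_left distrib_right mult.assoc)
  then show ?thesis by (rule vectorspace.intro[OF _ class_field])
qed

lemma abelian_subgroup_boundaries:
  assumes K: "simplicial_complex K"
  shows "abelian_subgroup (boundaries K p) (cycle_space K p :: ('k::field, 'a list \<Rightarrow> 'k) module)"
proof -
  let ?Z = "cycle_space K p :: ('k, 'a list \<Rightarrow> 'k) module"
  interpret vectorspace class_ring ?Z by (rule vectorspace_cycle_space[OF K])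
  have sub: "(boundaries K p :: ('a list \<Rightarrow> 'k) set) \<subseteq> carrier ?Z" using boundaries_subset_cycles[OF K] by simp
  have "subgroup (boundaries K p) (add_monoid ?Z)"
  proof (rule M.add.subgroupI)
    show "(boundaries K p :: ('a list \<Rightarrow> 'k) set) \<noteq> {}" using zero_boundary by blast
    fix b assume b: "b \<in> (boundaries K p :: ('a list \<Rightarrow> 'k) set)"
    have "\<ominus>\<^bsub>?Z\<^esub> b = (\<lambda>vs. - b vs)"
      using scale_boundary[OF K b, of "-1"] sub b by (intro M.minus_equality) auto
    then show "\<ominus>\<^bsub>?Z\<^esub> b \<in> boundaries K p" using scale_boundary[OF K b, of "-1"] by simp
  qed (use sub add_boundary[OF K] in auto)
  then show ?thesis
    by (intro abelian_subgroupI3 additive_subgroup.intro M.abelian_group_axioms)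
qed

text \<open>The coset is formed in \<open>chain_space\<close>, as in \<open>homology_map\<close>,
  whereas \<open>homology\<close> uses cosets in the space of cycles. Both spaces have the same
  addition, hence the same cosets.\<close>

definition homology_class :: "'a set set \<Rightarrow> nat \<Rightarrow> ('a list \<Rightarrow> 'k::field) \<Rightarrow> ('a list \<Rightarrow> 'k) set" where
  "homology_class K p z = boundaries K p +>\<^bsub>chain_space K p\<^esub> z"

lemma homology_class_eq: "homology_class K p z = {\<lambda>vs. b vs + z vs | b. b \<in> boundaries K p}"
  by (auto simp: homology_class_def a_r_coset_def' chain_space_def)

lemma homology_class_cycle_space: "boundaries K p +>\<^bsub>cycle_space K p\<^esub> z = homology_class K p z"
  by (auto simp: homology_class_eq a_r_coset_def')

lemma homology_quotient: "homology p K = quotient_space (cycle_space K p) (boundaries K p)"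
  by (simp add: homology_def cycle_space_def)

lemma vectorspace_homology:
  assumes "simplicial_complex K"
  shows "vectorspace class_ring (homology p K :: ('k::field, ('a list \<Rightarrow> 'k) set) module)"
  unfolding homology_quotient
  by (intro vectorspace_quotient_space vectorspace_cycle_space abelian_subgroup_boundaries assms)
    (simp add: scale_boundary[OF assms])

lemma carrier_homology: "carrier (homology p K) = homology_class K p ` cycles K p"
  by (simp add: homology_quotient quotient_space_carrier homology_class_cycle_space)

lemma homology_add:
  assumes "simplicial_complex K" "z \<in> cycles K p" "z' \<in> cycles K p"
  shows "homology_class K p z \<oplus>\<^bsub>homology p K\<^esub> homology_class K p z' = homology_class K p (\<lambda>vs. z vs + z' vs)"
  using quotient_space_add[OF abelian_subgroup_boundaries[OF assms(1)], of z p z'] assms(2,3)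
  by (simp add: homology_quotient homology_class_cycle_space)

lemma homology_smult:
  fixes z :: "'a list \<Rightarrow> 'k::field"
  assumes "simplicial_complex K" "z \<in> cycles K p"
  shows "r \<odot>\<^bsub>homology p K\<^esub> homology_class K p z = homology_class K p (\<lambda>vs. r * z vs)"
proof -
  interpret vectorspace class_ring "cycle_space K p :: ('k, 'a list \<Rightarrow> 'k) module"
    by (rule vectorspace_cycle_space[OF assms(1)])
  have "Module.module class_ring (cycle_space K p :: ('k, 'a list \<Rightarrow> 'k) module)" ..
  moreover have "a \<odot>\<^bsub>cycle_space K p\<^esub> b \<in> boundaries K p" if "b \<in> boundaries K p"
    for a :: 'k and b :: "'a list \<Rightarrow> 'k"
    using scale_boundary[OF assms(1) that] by simp
  moreover have "z \<in> carrier (cycle_space K p)" using assms(2) by simp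
  ultimately have "r \<odot>\<^bsub>quotient_space (cycle_space K p) (boundaries K p)\<^esub>
      (boundaries K p +>\<^bsub>cycle_space K p\<^esub> z) = boundaries K p +>\<^bsub>cycle_space K p\<^esub> (r \<odot>\<^bsub>cycle_space K p\<^esub> z)"
    by (intro quotient_space_smult abelian_subgroup_boundaries[OF assms(1)])
  then show ?thesis by (simp add: homology_quotient homology_class_cycle_space)
qed

lemma homology_class_eqI:
  fixes z z' :: "'a list \<Rightarrow> 'k::field"
  assumes "simplicial_complex K" "(\<lambda>vs. z vs - z' vs) \<in> boundaries K p"
  shows "homology_class K p z = homology_class K p z'"
proof -
  have sub: "homology_class K p y \<subseteq> homology_class K p y'" if "(\<lambda>vs. y vs - y' vs) \<in> boundaries K p" for y y' :: "'a list \<Rightarrow> 'k"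
  proof
    fix c assume "c \<in> homology_class K p y"
    then obtain b where b: "b \<in> boundaries K p" "c = (\<lambda>vs. b vs + y vs)"
      unfolding homology_class_eq by blast
    have "c = (\<lambda>vs. (b vs + (y vs - y' vs)) + y' vs)" unfolding b(2) by simp
    then show "c \<in> homology_class K p y'"
      unfolding homology_class_eq using add_boundary[OF assms(1) b(1) that]
      by (intro CollectI exI[of _ "\<lambda>vs. b vs + (y vs - y' vs)"] conjI)
  qed
  have "(\<lambda>vs. z' vs - z vs) \<in> boundaries K p"
    using scale_boundary[OF assms, of "-1"] by simp
  with sub[OF assms(2)] sub[OF this] show ?thesis by blast
qed

section \<open>Maps induced on homology\<close>

text \<open>Representatives differ by boundaries, which go to boundaries, so the union in
  \<open>homology_map\<close> is a union of equal classes.\<close>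

lemma homology_map_class:
  assumes K: "simplicial_complex K" and L: "simplicial_complex L" and f: "simplicial_map f K L"
    and z: "z \<in> cycles K p"
  shows "homology_map p K L f (homology_class K p z) = homology_class L p (chain_map f z)"
proof -
  have "homology_class L p (chain_map f c) = homology_class L p (chain_map f z)"
    if c: "c \<in> homology_class K p z" for c
  proof (rule homology_class_eqI[OF L])
    obtain b where b: "b \<in> boundaries K p" "c = (\<lambda>vs. b vs + z vs)"
      using c unfolding homology_class_eq by blast
    have "b \<in> oriented_chains K p"
      using subsetD[OF boundaries_subset_cycles[OF K] b(1)] cyclesD(1)[OF K] by blast
    then have "chain_map f c = (\<lambda>ws. chain_map f b ws + chain_map f z ws)"
      using chain_map_linear[OF K _ cyclesD(1)[OF K z], of b f 1 1] b(2) by simp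
    then show "(\<lambda>ws. chain_map f c ws - chain_map f z ws) \<in> boundaries L p"
      using chain_map_boundaries[OF K L f b(1)] by simp
  qed
  moreover have "z \<in> homology_class K p z"
    unfolding homology_class_eq by (intro CollectI exI[of _ "\<lambda>_. 0"] conjI zero_boundary) simp
  ultimately have "(\<Union>c\<in>homology_class K p z. homology_class L p (chain_map f c)) =
      homology_class L p (chain_map f z)" by blast
  then show ?thesis
    using z by (simp add: homology_map_def carrier_homology homology_class_def)
qed

lemma homology_map_linear:
  assumes K: "simplicial_complex K" and L: "simplicial_complex L" and f: "simplicial_map f K L"
  shows "homology_map p K L f \<in> vect_hom (homology p K) (homology p L :: ('k::field, _) module)"
proof -
  let ?h = "homology_map p K L f :: ('a list \<Rightarrow> 'k) set \<Rightarrow> _"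
  interpret V: vectorspace class_ring "homology p K :: ('k, _) module" by (rule vectorspace_homology[OF K])
  interpret W: vectorspace class_ring "homology p L :: ('k, _) module" by (rule vectorspace_homology[OF L])
  have "?h \<in> LinearCombinations.module_hom class_ring (homology p K) (homology p L)"
    unfolding LinearCombinations.module_hom_def
  proof (intro CollectI conjI allI impI Pi_I; (elim conjE)?)
    fix C assume "C \<in> carrier (homology p K :: ('k, _) module)"
    then obtain z where z: "z \<in> cycles K p" "C = homology_class K p z" unfolding carrier_homology by blast
    show "?h C \<in> carrier (homology p L)"
      unfolding z(2) homology_map_class[OF K L f z(1)] carrier_homology
      by (intro imageI chain_map_cycles[OF K L f z(1)])
    show "?h (r \<odot>\<^bsub>homology p K\<^esub> C) = r \<odot>\<^bsub>homology p L\<^esub> ?h C" for r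
      using chain_map_linear[OF K cyclesD(1)[OF K z(1)] cyclesD(1)[OF K z(1)], of f r 0]
      by (simp add: z(2) homology_map_class[OF K L f] z(1) homology_smult[OF K] homology_smult[OF L]
        scale_cycle[OF K] chain_map_cycles[OF K L f])
    fix C' assume "C' \<in> carrier (homology p K :: ('k, _) module)"
    then obtain z' where z': "z' \<in> cycles K p" "C' = homology_class K p z'" unfolding carrier_homology by blast
    show "?h (C \<oplus>\<^bsub>homology p K\<^esub> C') = ?h C \<oplus>\<^bsub>homology p L\<^esub> ?h C'"
      using chain_map_linear[OF K cyclesD(1)[OF K z(1)] cyclesD(1)[OF K z'(1)], of f 1 1]
      by (simp add: z(2) z'(2) homology_map_class[OF K L f] z(1) z'(1) homology_add[OF K] homology_add[OF L]
        add_cycle[OF K] chain_map_cycles[OF K L f])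
  qed
  then have "linear_map class_ring (homology p K) (homology p L) ?h"
    by (intro linear_map.intro mod_hom.intro mod_hom_axioms.intro V.vectorspace_axioms W.vectorspace_axioms
      V.module_axioms W.module_axioms)
  then show ?thesis unfolding vect_hom_def homology_map_def by simp
qed

lemma homology_map_comp:
  assumes K: "simplicial_complex K" and L: "simplicial_complex L" and M: "simplicial_complex M"
    and f: "simplicial_map f K L" and g: "simplicial_map g L M"
  shows "compose (carrier (homology p K)) (homology_map p L M g) (homology_map p K L f) =
    (homology_map p K M (\<lambda>x. g (f x)) :: ('a list \<Rightarrow> 'k::field) set \<Rightarrow> _)"
proof (rule extensionalityI)
  have gf: "simplicial_map (\<lambda>x. g (f x)) K M"
    using f g unfolding simplicial_map_def by (metis image_image)
  fix C assume "C \<in> carrier (homology p K :: ('k, _) module)"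
  then obtain z where z: "z \<in> cycles K p" "C = homology_class K p z" unfolding carrier_homology by blast
  then show "compose (carrier (homology p K)) (homology_map p L M g) (homology_map p K L f) C =
      homology_map p K M (\<lambda>x. g (f x)) C"
    by (simp add: compose_def carrier_homology homology_map_class[OF K L f] homology_map_class[OF L M g]
      homology_map_class[OF K M gf] chain_map_cycles[OF K L f] chain_map_comp[OF K L f cyclesD(1)[OF K]])
qed (simp_all add: homology_map_def)

lemma homology_map_id:
  assumes "simplicial_complex K"
  shows "homology_map p K K (\<lambda>x. x) = (\<lambda>C \<in> carrier (homology p K :: ('k::field, _) module). C)"
proof (rule extensionalityI)
  have id: "simplicial_map (\<lambda>x. x) K K" by (simp add: simplicial_map_def)
  fix C assume "C \<in> carrier (homology p K :: ('k, _) module)"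
  then show "homology_map p K K (\<lambda>x. x) C = (\<lambda>C \<in> carrier (homology p K). C) C"
    by (auto simp: carrier_homology homology_map_class[OF assms assms id] chain_map_id)
qed (simp_all add: homology_map_def)

lemma homology_map_contiguous:
  assumes K: "simplicial_complex K" and L: "simplicial_complex L" and cont: "contiguous f g K L"
  shows "homology_map p K L f = (homology_map p K L g :: ('a list \<Rightarrow> 'k::field) set \<Rightarrow> _)"
proof (rule extensionalityI)
  note f = contiguous_simplicial_map(1)[OF K L cont] and g = contiguous_simplicial_map(2)[OF K L cont]
  fix C assume "C \<in> carrier (homology p K :: ('k, _) module)"
  then obtain z where z: "z \<in> cycles K p" "C = homology_class K p z" unfolding carrier_homology by blast
  show "homology_map p K L f C = homology_map p K L g C"
    unfolding z(2) homology_map_class[OF K L f z(1)] homology_map_class[OF K L g z(1)]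
    by (rule homology_class_eqI[OF L contiguous_homologous[OF K L cont z(1)]])
qed (simp_all add: homology_map_def)

section \<open>Persistent homology of data sets\<close>

lemma simplicial_complex_sublevel_VR:
  assumes "finite X"
  shows "simplicial_complex (sublevel_VR X \<Phi> \<phi> p)"
proof -
  have "\<Union>(sublevel_VR X \<Phi> \<phi> p) \<subseteq> X"
    unfolding sublevel_VR_def vietoris_rips_def by blast
  then have "finite (\<Union>(sublevel_VR X \<Phi> \<phi> p))" using assms by (rule finite_subset)
  moreover have "\<tau> \<in> sublevel_VR X \<Phi> \<phi> p" if "\<sigma> \<in> sublevel_VR X \<Phi> \<phi> p" "\<tau> \<subseteq> \<sigma>" "\<tau> \<noteq> {}" for \<sigma> \<tau>
    using that finite_subset[of \<tau> \<sigma>] unfolding sublevel_VR_def vietoris_rips_def by blast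
  moreover have "{} \<notin> sublevel_VR X \<Phi> \<phi> p" unfolding sublevel_VR_def vietoris_rips_def by blast
  ultimately show ?thesis unfolding simplicial_complex_def by blast
qed

lemma simplicial_map_sublevel_VR_inclusion:
  assumes "grid_le p q"
  shows "simplicial_map (\<lambda>x. x) (sublevel_VR X \<Phi> \<phi> p) (sublevel_VR X \<Phi> \<phi> q)"
  using assms unfolding simplicial_map_def sublevel_VR_def vietoris_rips_def grid_le_def by force

lemma data_dist_le_iff:
  assumes "finite \<Phi>" "\<Phi> \<noteq> {}"
  shows "data_dist \<Phi> x y \<le> r \<longleftrightarrow> (\<forall>\<phi>\<in>\<Phi>. \<bar>\<phi> x - \<phi> y\<bar> \<le> r)"
  using assms by (simp add: data_dist_def)

text \<open>Points of \<open>f\<close> \<sigma> \<union> g \<open>\<sigma>\<close> carry the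
  measurements of points of \<sigma>, whichever map they come from, so distances do not grow. The
  hypotheses are pointwise in order to cover composites of realizations, which need not be
  extensional.\<close>

lemma realizations_contiguous:
  assumes "finite \<Phi>" "finite \<Psi>" "\<gamma> \<in> \<Phi> \<rightarrow> \<Psi>" "\<phi> \<in> \<Phi>"
    and f: "\<And>y. y \<in> Y \<Longrightarrow> f y \<in> X" "\<And>\<chi> y. \<chi> \<in> \<Phi> \<Longrightarrow> y \<in> Y \<Longrightarrow> \<chi> (f y) = \<gamma> \<chi> y"
    and g: "\<And>y. y \<in> Y \<Longrightarrow> g y \<in> X" "\<And>\<chi> y. \<chi> \<in> \<Phi> \<Longrightarrow> y \<in> Y \<Longrightarrow> \<chi> (g y) = \<gamma> \<chi> y"
  shows "contiguous f g (sublevel_VR Y \<Psi> (\<gamma> \<phi>) p) (sublevel_VR X \<Phi> \<phi> p)"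
  unfolding contiguous_def
proof
  fix \<sigma> assume "\<sigma> \<in> sublevel_VR Y \<Psi> (\<gamma> \<phi>) p"
  then have \<sigma>: "\<sigma> \<noteq> {}" "finite \<sigma>" "\<sigma> \<subseteq> Y" "\<And>y. y \<in> \<sigma> \<Longrightarrow> \<gamma> \<phi> y \<le> snd p"
    "\<And>y y'. y \<in> \<sigma> \<Longrightarrow> y' \<in> \<sigma> \<Longrightarrow> data_dist \<Psi> y y' \<le> fst p"
    unfolding sublevel_VR_def vietoris_rips_def by auto
  let ?\<tau> = "f ` \<sigma> \<union> g ` \<sigma>"
  have \<tau>: "\<exists>y\<in>\<sigma>. u \<in> X \<and> (\<forall>\<chi>\<in>\<Phi>. \<chi> u = \<gamma> \<chi> y)" if "u \<in> ?\<tau>" for u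
    using that f g \<sigma>(3) by blast
  have "u \<in> X \<and> \<phi> u \<le> snd p" if "u \<in> ?\<tau>" for u
    using \<tau>[OF that] assms(4) \<sigma>(4) by auto
  moreover have "data_dist \<Phi> u u' \<le> fst p" if "u \<in> ?\<tau>" "u' \<in> ?\<tau>" for u u'
  proof -
    obtain y where y: "y \<in> \<sigma>" "\<forall>\<chi>\<in>\<Phi>. \<chi> u = \<gamma> \<chi> y" using \<tau>[OF \<open>u \<in> ?\<tau>\<close>] by blast
    obtain y' where y': "y' \<in> \<sigma>" "\<forall>\<chi>\<in>\<Phi>. \<chi> u' = \<gamma> \<chi> y'" using \<tau>[OF \<open>u' \<in> ?\<tau>\<close>] by blast
    \<comment> \<open>The maximum in \<open>data_dist\<close> has a meaning only for nonempty data
      sets; \<phi> and its image provide elements.\<close>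
    have ne: "\<Phi> \<noteq> {}" "\<Psi> \<noteq> {}" using assms(3,4) by auto
    have "\<forall>\<psi>\<in>\<Psi>. \<bar>\<psi> y - \<psi> y'\<bar> \<le> fst p"
      using \<sigma>(5)[OF y(1) y'(1)] unfolding data_dist_le_iff[OF assms(2) ne(2)] .
    \<comment> \<open>Here \<gamma> being valued in \<Psi> enters: the differences of
      \<open>\<gamma> \<chi>\<close> are among those bounded by
      \<open>data_dist \<Psi>\<close>.\<close>
    then have "\<bar>\<gamma> \<chi> y - \<gamma> \<chi> y'\<bar> \<le> fst p" if "\<chi> \<in> \<Phi>" for \<chi>
      using funcset_mem[OF assms(3) that] by (rule bspec)
    then show ?thesis
      using y(2) y'(2) unfolding data_dist_le_iff[OF assms(1) ne(1)] by simp
  qed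
  ultimately show "?\<tau> \<in> sublevel_VR X \<Phi> \<phi> p"
    unfolding sublevel_VR_def vietoris_rips_def using \<sigma>(1,2) by blast
qed

lemma realizesD:
  assumes "realizes X \<Phi> Y \<gamma> f" "y \<in> Y"
  shows "f y \<in> X" "\<chi> \<in> \<Phi> \<Longrightarrow> \<chi> (f y) = \<gamma> \<chi> y"
  using assms unfolding realizes_def by (auto simp: compose_def)

text \<open>A realization is contiguous to itself.\<close>

lemma realizes_simplicial_map:
  assumes "data_set X \<Phi>" "data_set Y \<Psi>" "\<gamma> \<in> \<Phi> \<rightarrow> \<Psi>" "realizes X \<Phi> Y \<gamma> f" "\<phi> \<in> \<Phi>"
  shows "simplicial_map f (sublevel_VR Y \<Psi> (\<gamma> \<phi>) p) (sublevel_VR X \<Phi> \<phi> p)"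
proof -
  have "finite X" "finite Y" "finite \<Phi>" "finite \<Psi>" using assms(1,2) unfolding data_set_def by auto
  then show ?thesis
    by (intro contiguous_simplicial_map(1)[where g = f] simplicial_complex_sublevel_VR
      realizations_contiguous assms(3,5) realizesD[OF assms(4)])
qed

section \<open>Persistence modules and their morphisms\<close>

lemma persistence_module_PH:
  assumes "finite X"
  shows "persistence_module (PH d X \<Phi> \<phi> :: ('k::field, _) pers)"
proof -
  note K = simplicial_complex_sublevel_VR[OF assms] and i = simplicial_map_sublevel_VR_inclusion
  show ?thesis
    unfolding persistence_module_def PH_def pers.simps
  proof (intro conjI ballI impI)
    fix p q r assume "grid_le p q" "grid_le q r"
    then show "homology_map d (sublevel_VR X \<Phi> \<phi> p) (sublevel_VR X \<Phi> \<phi> r) (\<lambda>x. x) =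
      compose (carrier (homology d (sublevel_VR X \<Phi> \<phi> p) :: ('k, _) module))
       (homology_map d (sublevel_VR X \<Phi> \<phi> q) (sublevel_VR X \<Phi> \<phi> r) (\<lambda>x. x))
       (homology_map d (sublevel_VR X \<Phi> \<phi> p) (sublevel_VR X \<Phi> \<phi> q) (\<lambda>x. x))"
      by (intro homology_map_comp[symmetric] K i)
  qed (intro vectorspace_homology homology_map_linear homology_map_id K i; assumption)+
qed

text \<open>The choice made by \<open>SOME\<close> depends neither on \<phi> nor on the grid point,
  so one \<open>f'\<close> serves the whole family. It need not be the given
  \<open>f\<close>.\<close>

lemma PH_map_realization:
  assumes "realizes X \<Phi> Y \<gamma> f"
  obtains f' where "realizes X \<Phi> Y \<gamma> f'"
    "PH_map d X \<Phi> Y \<Psi> \<gamma> = (\<lambda>\<phi>. \<lambda>p\<in>grid.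
       homology_map d (sublevel_VR Y \<Psi> (\<gamma> \<phi>) p) (sublevel_VR X \<Phi> \<phi> p) f')"
proof (rule that)
  show "realizes X \<Phi> Y \<gamma> (SOME f. realizes X \<Phi> Y \<gamma> f)" 
    by (rule someI[of "realizes X \<Phi> Y \<gamma>", OF assms])
qed (rule ext, rule PH_map_def)

lemma PH_map_pers_hom:
  assumes "data_set X \<Phi>" "data_set Y \<Psi>" "\<gamma> \<in> \<Phi> \<rightarrow> \<Psi>" "realizes X \<Phi> Y \<gamma> f" "\<phi> \<in> \<Phi>"
  shows "PH_map d X \<Phi> Y \<Psi> \<gamma> \<phi> \<in> pers_hom (PH d Y \<Psi> (\<gamma> \<phi>)) (PH d X \<Phi> \<phi> :: ('k::field, _) pers)"
proof -
  obtain f' where f': "realizes X \<Phi> Y \<gamma> f'" and eq: "(PH_map d X \<Phi> Y \<Psi> \<gamma> :: _ \<Rightarrow> _ \<Rightarrow> (_ \<Rightarrow> 'k) set \<Rightarrow> _) =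
      (\<lambda>\<phi>. \<lambda>p\<in>grid. homology_map d (sublevel_VR Y \<Psi> (\<gamma> \<phi>) p) (sublevel_VR X \<Phi> \<phi> p) f')"
    by (rule PH_map_realization[OF assms(4)])
  have fin: "finite X" "finite Y" using assms(1,2) unfolding data_set_def by auto
  note K = simplicial_complex_sublevel_VR[OF fin(1)] simplicial_complex_sublevel_VR[OF fin(2)]
    and i = simplicial_map_sublevel_VR_inclusion
    and f = realizes_simplicial_map[OF assms(1-3) f' assms(5)]
  show ?thesis
    unfolding pers_hom_def PH_def pers.simps eq
  proof (intro CollectI conjI ballI impI)
    fix p assume p: "p \<in> grid"
    then show "(\<lambda>p\<in>grid. homology_map d (sublevel_VR Y \<Psi> (\<gamma> \<phi>) p) (sublevel_VR X \<Phi> \<phi> p) f') p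
      \<in> vect_hom (homology d (sublevel_VR Y \<Psi> (\<gamma> \<phi>) p)) (homology d (sublevel_VR X \<Phi> \<phi> p) :: ('k, _) module)"
      by (simp add: homology_map_linear K f)
    fix q assume "q \<in> grid" "grid_le p q"
    \<comment> \<open>Both composites are induced by \<open>f'\<close>, since the transitions come
      from the identity on vertices.\<close>
    then show "compose (carrier (homology d (sublevel_VR Y \<Psi> (\<gamma> \<phi>) p) :: ('k, _) module))
        ((\<lambda>p\<in>grid. homology_map d (sublevel_VR Y \<Psi> (\<gamma> \<phi>) p) (sublevel_VR X \<Phi> \<phi> p) f') q)
        (homology_map d (sublevel_VR Y \<Psi> (\<gamma> \<phi>) p) (sublevel_VR Y \<Psi> (\<gamma> \<phi>) q) (\<lambda>x. x)) =
      compose (carrier (homology d (sublevel_VR Y \<Psi> (\<gamma> \<phi>) p) :: ('k, _) module))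
        (homology_map d (sublevel_VR X \<Phi> \<phi> p) (sublevel_VR X \<Phi> \<phi> q) (\<lambda>x. x))
        ((\<lambda>p\<in>grid. homology_map d (sublevel_VR Y \<Psi> (\<gamma> \<phi>) p) (sublevel_VR X \<Phi> \<phi> p) f') p)"
      using p by (simp add: homology_map_comp[OF K(2) K(2) K(1) i f]
          homology_map_comp[OF K(2) K(1) K(1) f i])
  qed simp
qed

section \<open>Naturality squares\<close>

text \<open>The two paths are factorizations, through \<Psi> and through \<Theta>, of one function
  from \<Phi> to \<Omega>. Both composite realizations realize that function, hence are
  contiguous.\<close>

lemma PH_map_square:
  assumes data: "data_set X \<Phi>" "data_set Y \<Psi>" "data_set Z \<Omega>" "data_set W \<Theta>"
    and \<gamma>: "\<gamma> \<in> \<Phi> \<rightarrow> \<Psi>" "realizes X \<Phi> Y \<gamma> f" and \<delta>: "\<delta> \<in> \<Psi> \<rightarrow> \<Omega>" "realizes Y \<Psi> Z \<delta> g"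
    and \<gamma>': "\<gamma>' \<in> \<Phi> \<rightarrow> \<Theta>" "realizes X \<Phi> W \<gamma>' f'" and \<delta>': "\<delta>' \<in> \<Theta> \<rightarrow> \<Omega>" "realizes W \<Theta> Z \<delta>' g'"
    and eq: "\<And>\<chi>. \<chi> \<in> \<Phi> \<Longrightarrow> \<delta> (\<gamma> \<chi>) = \<delta>' (\<gamma>' \<chi>)" and \<phi>: "\<phi> \<in> \<Phi>"
  shows "pers_comp (PH d Z \<Omega> (\<delta> (\<gamma> \<phi>)) :: ('k::field, _) pers)
      (PH_map d X \<Phi> Y \<Psi> \<gamma> \<phi>) (PH_map d Y \<Psi> Z \<Omega> \<delta> (\<gamma> \<phi>)) =
    pers_comp (PH d Z \<Omega> (\<delta> (\<gamma> \<phi>)) :: ('k, _) pers)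
      (PH_map d X \<Phi> W \<Theta> \<gamma>' \<phi> :: _ \<Rightarrow> _ \<Rightarrow> (_ \<Rightarrow> 'k) set) (PH_map d W \<Theta> Z \<Omega> \<delta>' (\<gamma>' \<phi>))"
proof -
  have fin: "finite X" "finite Y" "finite Z" "finite W" "finite \<Phi>" "finite \<Omega>"
    using data unfolding data_set_def by auto
  note X = simplicial_complex_sublevel_VR[OF fin(1)] and Y = simplicial_complex_sublevel_VR[OF fin(2)]
    and Z = simplicial_complex_sublevel_VR[OF fin(3)] and W = simplicial_complex_sublevel_VR[OF fin(4)]
  \<comment> \<open>The four realizations are chosen independently, so \<open>a (b z)\<close> and
    \<open>a' (b' z)\<close> may be different points; only their measurements agree.\<close>
  obtain a where a: "realizes X \<Phi> Y \<gamma> a" and a_eq: "(PH_map d X \<Phi> Y \<Psi> \<gamma> :: _ \<Rightarrow> _ \<Rightarrow> (_ \<Rightarrow> 'k) set \<Rightarrow> _) =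
      (\<lambda>\<phi>. \<lambda>p\<in>grid. homology_map d (sublevel_VR Y \<Psi> (\<gamma> \<phi>) p) (sublevel_VR X \<Phi> \<phi> p) a)"
    by (rule PH_map_realization[OF \<gamma>(2)])
  obtain b where b: "realizes Y \<Psi> Z \<delta> b" and b_eq: "(PH_map d Y \<Psi> Z \<Omega> \<delta> :: _ \<Rightarrow> _ \<Rightarrow> (_ \<Rightarrow> 'k) set \<Rightarrow> _) =
      (\<lambda>\<phi>. \<lambda>p\<in>grid. homology_map d (sublevel_VR Z \<Omega> (\<delta> \<phi>) p) (sublevel_VR Y \<Psi> \<phi> p) b)"
    by (rule PH_map_realization[OF \<delta>(2)])
  obtain a' where a': "realizes X \<Phi> W \<gamma>' a'" and a'_eq: "(PH_map d X \<Phi> W \<Theta> \<gamma>' :: _ \<Rightarrow> _ \<Rightarrow> (_ \<Rightarrow> 'k) set \<Rightarrow> _) =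
      (\<lambda>\<phi>. \<lambda>p\<in>grid. homology_map d (sublevel_VR W \<Theta> (\<gamma>' \<phi>) p) (sublevel_VR X \<Phi> \<phi> p) a')"
    by (rule PH_map_realization[OF \<gamma>'(2)])
  obtain b' where b': "realizes W \<Theta> Z \<delta>' b'" and b'_eq: "(PH_map d W \<Theta> Z \<Omega> \<delta>' :: _ \<Rightarrow> _ \<Rightarrow> (_ \<Rightarrow> 'k) set \<Rightarrow> _) =
      (\<lambda>\<phi>. \<lambda>p\<in>grid. homology_map d (sublevel_VR Z \<Omega> (\<delta>' \<phi>) p) (sublevel_VR W \<Theta> \<phi> p) b')"
    by (rule PH_map_realization[OF \<delta>'(2)])
  have mem: "\<gamma> \<chi> \<in> \<Psi>" "\<gamma>' \<chi> \<in> \<Theta>" if "\<chi> \<in> \<Phi>" for \<chi> using \<gamma>(1) \<gamma>'(1) that by auto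
  \<comment> \<open>Folding with \<open>eq\<close> gives both paths the same source complex.\<close>
  note as = realizes_simplicial_map[OF data(1,2) \<gamma>(1) a \<phi>]
    and bs = realizes_simplicial_map[OF data(2,3) \<delta>(1) b mem(1)[OF \<phi>]]
    and as' = realizes_simplicial_map[OF data(1,4) \<gamma>'(1) a' \<phi>]
    and bs' = realizes_simplicial_map[OF data(4,3) \<delta>'(1) b' mem(2)[OF \<phi>], folded eq[OF \<phi>]]
  have "homology_map d (sublevel_VR Z \<Omega> (\<delta> (\<gamma> \<phi>)) p) (sublevel_VR X \<Phi> \<phi> p) (\<lambda>z. a (b z)) =
      (homology_map d (sublevel_VR Z \<Omega> (\<delta> (\<gamma> \<phi>)) p) (sublevel_VR X \<Phi> \<phi> p) (\<lambda>z. a' (b' z))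
        :: (_ \<Rightarrow> 'k) set \<Rightarrow> _)" for p
  proof (rule homology_map_contiguous[OF Z X],
      rule realizations_contiguous[OF fin(5,6) _ \<phi>, where \<gamma> = "\<lambda>\<chi>. \<delta> (\<gamma> \<chi>)"])
    show "(\<lambda>\<chi>. \<delta> (\<gamma> \<chi>)) \<in> \<Phi> \<rightarrow> \<Omega>" using \<gamma>(1) \<delta>(1) by auto
    fix z assume z: "z \<in> Z"
    note bz = realizesD(1)[OF b z] and bz' = realizesD(1)[OF b' z]
    show "a (b z) \<in> X" "a' (b' z) \<in> X" using realizesD(1)[OF a bz] realizesD(1)[OF a' bz'] .
    fix \<chi> assume \<chi>: "\<chi> \<in> \<Phi>"
    show "\<chi> (a (b z)) = \<delta> (\<gamma> \<chi>) z"
      using realizesD(2)[OF a bz \<chi>] realizesD(2)[OF b z mem(1)[OF \<chi>]] by simp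
    show "\<chi> (a' (b' z)) = \<delta> (\<gamma> \<chi>) z"
      using realizesD(2)[OF a' bz' \<chi>] realizesD(2)[OF b' z mem(2)[OF \<chi>]] eq[OF \<chi>] by simp
  qed
  then show ?thesis
    unfolding pers_comp_def a_eq b_eq a'_eq b'_eq PH_def pers.simps
    by (intro restrict_ext)
      (simp add: homology_map_comp[OF Z Y X bs as] homology_map_comp[OF Z W X bs' as'] flip: eq[OF \<phi>])
qed

theorem mainTheorem3:
  fixes X :: "'a set" and \<Phi> :: "('a \<Rightarrow> real) set" and M :: "('a \<Rightarrow> 'a) set"
    and Y :: "'b set" and \<Psi> :: "('b \<Rightarrow> real) set" and N :: "('b \<Rightarrow> 'b) set"
    and \<alpha> :: "('a \<Rightarrow> real) \<Rightarrow> 'b \<Rightarrow> real" and T :: "('a \<Rightarrow> 'a) \<Rightarrow> 'b \<Rightarrow> 'b" and d :: nat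
  assumes "incarnation X \<Phi> M" and "incarnation Y \<Psi> N"
    and "geometric_SEO X \<Phi> M Y \<Psi> N \<alpha> T"
  shows "natural_transformation (grothendieck_graph X \<Phi> M)
    (SEO_composite \<alpha> T (PH_functor d Y \<Psi>))
    (PH_functor d X \<Phi>)
    (PH_map d X \<Phi> Y \<Psi> \<alpha> :: ('a \<Rightarrow> real) \<Rightarrow> real \<times> real \<Rightarrow>
       ('b list \<Rightarrow> 'k::field) set \<Rightarrow> ('a list \<Rightarrow> 'k) set)"
proof -
  have X: "data_set X \<Phi>" and Y: "data_set Y \<Psi>" and fin: "finite X" "finite Y"
    using assms(1,2) unfolding incarnation_def data_set_def by auto
  \<comment> \<open>The operation \<open>-g\<close> is realized by \<open>g\<close> itself.\<close>
  have g: "(\<lambda>\<chi>. compose X \<chi> g) \<in> \<Phi> \<rightarrow> \<Phi>" "realizes X \<Phi> X (\<lambda>\<chi>. compose X \<chi> g) g" if "g \<in> M" for g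
    using assms(1) that unfolding incarnation_def data_End_def realizes_def by auto
  have h: "(\<lambda>\<chi>. compose Y \<chi> h) \<in> \<Psi> \<rightarrow> \<Psi>" "realizes Y \<Psi> Y (\<lambda>\<chi>. compose Y \<chi> h) h" if "h \<in> N" for h
    using assms(2) that unfolding incarnation_def data_End_def realizes_def by auto
  obtain f where f: "realizes X \<Phi> Y \<alpha> f" using assms(3) unfolding geometric_SEO_def by blast
  have \<alpha>: "\<alpha> \<in> \<Phi> \<rightarrow> \<Psi>" and T: "\<And>g. g \<in> M \<Longrightarrow> T g \<in> N"
    and eq: "\<And>\<phi> g. \<phi> \<in> \<Phi> \<Longrightarrow> g \<in> M \<Longrightarrow> \<alpha> (compose X \<phi> g) = compose Y (\<alpha> \<phi>) (T g)"
    using assms(3) unfolding geometric_SEO_def is_SEO_def by auto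
  \<comment> \<open>The equivariance equation identifies the object at the head of an edge with the
    source of the morphism induced by \<open>T g\<close>.\<close>
  have "is_graph_functor (grothendieck_graph X \<Phi> M)
      (SEO_composite \<alpha> T (PH_functor d Y \<Psi>) :: (_, _, 'k, _) graph_functor)"
    unfolding is_graph_functor_def SEO_composite_def PH_functor_def grothendieck_graph_def
    using PH_map_pers_hom[OF Y Y h[OF T]] \<alpha> persistence_module_PH[OF fin(2)] by (auto simp: eq)
  moreover have "is_graph_functor (grothendieck_graph X \<Phi> M) (PH_functor d X \<Phi> :: (_, _, 'k, _) graph_functor)"
    unfolding is_graph_functor_def PH_functor_def grothendieck_graph_def
    using PH_map_pers_hom[OF X X g] persistence_module_PH[OF fin(1)] by auto
  moreover have "PH_map d X \<Phi> Y \<Psi> \<alpha> \<phi> \<in> pers_hom (PH d Y \<Psi> (\<alpha> \<phi>)) (PH d X \<Phi> \<phi> :: ('k, _) pers)"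
    if "\<phi> \<in> \<Phi>" for \<phi>
    by (rule PH_map_pers_hom[OF X Y \<alpha> f that])
  \<comment> \<open>One path first applies \<open>-g\<close> to measurements and then \<alpha>, the
    other first \<alpha> and then \<open>-T(g)\<close>; the hypothesis \<open>eq\<close> of the
    square is the equivariance of \<alpha>.\<close>
  moreover have "pers_comp (PH d Y \<Psi> (\<alpha> (compose X \<phi> g)) :: ('k, _) pers)
      (PH_map d X \<Phi> X \<Phi> (\<lambda>\<chi>. compose X \<chi> g) \<phi>) (PH_map d X \<Phi> Y \<Psi> \<alpha> (compose X \<phi> g)) =
    pers_comp (PH d Y \<Psi> (\<alpha> (compose X \<phi> g)) :: ('k, _) pers)
      (PH_map d X \<Phi> Y \<Psi> \<alpha> \<phi> :: _ \<Rightarrow> _ \<Rightarrow> (_ \<Rightarrow> 'k) set) (PH_map d Y \<Psi> Y \<Psi> (\<lambda>\<chi>. compose Y \<chi> (T g)) (\<alpha> \<phi>))"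
    if "\<phi> \<in> \<Phi>" "g \<in> M" for \<phi> g
    by (rule PH_map_square[where \<gamma> = "\<lambda>\<chi>. compose X \<chi> g" and \<delta> = \<alpha> and \<gamma>' = \<alpha>
          and \<delta>' = "\<lambda>\<chi>. compose Y \<chi> (T g)",
        OF X X Y Y g[OF that(2)] \<alpha> f \<alpha> f h[OF T[OF that(2)]] eq[OF _ that(2)] that(1)])
  ultimately show ?thesis
    unfolding natural_transformation_def
    by (auto simp: SEO_composite_def PH_functor_def grothendieck_graph_def)
qed

end
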